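(* Let $D=(0,1)$, $\alpha\in(3/2,2)$, $V=H^1_0(D)$, and let $q\in L^\infty(D)$ and $p\in L^2(D)$. Define on $V\times V$ the bilinear forms $$a(\psi,\varphi)=(\psi',\varphi'),\qquad b(\psi,\varphi)=\big({}_0^RD_x^{2-\alpha}\psi,\,q\varphi\big)+\big({}_0^RD_x^{2-\alpha}\psi\big)(1)\,(p,\varphi),\qquad A=a+b,$$ and assume: (a) if $w\in V$ satisfies $A(w,v)=0$ for all $v\in V$, then $w=0$; and (a$^*$) if $v\in V$ satisfies $A(w,v)=0$ for all $w\in V$, then $v=0$. Then for every $F\in V^*=H^{-1}(D)$ there exists a unique $w\in V$ such that $$A(w,\varphi)=\langle F,\varphi\rangle\quad\text{for all }\varphi\in V,$$ where $\langle\cdot,\cdot\rangle$ is the duality pairing between $V^*$ and $V$.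
   Context: $(\cdot,\cdot)$ denotes the $L^2(D)$ inner product. For $\gamma>0$ the left-sided Riemann–Liouville integral is $({}_0I_x^\gamma g)(x)=\frac{1}{\Gamma(\gamma)}\int_0^x(x-t)^{\gamma-1}g(t)\,dt$. For $w\in H^1_0(D)$ and $\alpha\in(3/2,2)$, the Riemann–Liouville derivative of order $2-\alpha$ is ${}_0^RD_x^{2-\alpha}w=\frac{d}{dx}({}_0I_x^{\alpha-1}w)={}_0I_x^{\alpha-1}(w')$, i.e. $({}_0^RD_x^{2-\alpha}w)(x)=\frac{1}{\Gamma(\alpha-1)}\int_0^x(x-t)^{\alpha-2}w'(t)\,dt$, and in particular $({}_0^RD_x^{2-\alpha}w)(1)=\frac{1}{\Gamma(\alpha-1)}\int_0^1(1-t)^{\alpha-2}w'(t)\,dt$ (well defined since $(1-t)^{\alpha-2}\in L^2(D)$ for $\alpha>3/2$). $V=H^1_0(D)$ carries the norm $\|w'\|_{L^2(D)}$. *)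

theory Defs
  imports "HOL-Analysis.Analysis"
begin

definition L2D :: "(real \<Rightarrow> real) \<Rightarrow> bool" where
  "L2D f \<longleftrightarrow> set_borel_measurable lborel {0<..<1} f
     \<and> set_integrable lborel {0<..<1} (\<lambda>x. (f x)\<^sup>2)"

definition LinfD :: "(real \<Rightarrow> real) \<Rightarrow> bool" where
  "LinfD f \<longleftrightarrow> set_borel_measurable lborel {0<..<1} f
     \<and> (\<exists>C. AE x in lborel. x \<in> {0<..<1} \<longrightarrow> \<bar>f x\<bar> \<le> C)"

definition ipD :: "(real \<Rightarrow> real) \<Rightarrow> (real \<Rightarrow> real) \<Rightarrow> real" where
  "ipD f g = (LINT x:{0<..<1}|lborel. f x * g x)"

text \<open>H^1_0(D), each element represented by its (absolutely) continuous
  representative on [0,1], extended by zero outside [0,1]: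
  w(x) = integral from 0 to x of an L^2 weak derivative g, with w(1) = 0.\<close>
definition H10 :: "(real \<Rightarrow> real) set" where
  "H10 = {w. \<exists>g. L2D g \<and> (LINT t:{0<..<1}|lborel. g t) = 0
      \<and> (\<forall>x. w x = (if x \<in> {0..1} then (LINT t:{0<..<x}|lborel. g t) else 0))}"

text \<open>Weak derivative w' of an element of H^1_0(D) (determined a.e. on D).\<close>
definition wderiv :: "(real \<Rightarrow> real) \<Rightarrow> real \<Rightarrow> real" where
  "wderiv w = (SOME g. L2D g \<and> (LINT t:{0<..<1}|lborel. g t) = 0
      \<and> (\<forall>x. w x = (if x \<in> {0..1} then (LINT t:{0<..<x}|lborel. g t) else 0)))"

definition normV :: "(real \<Rightarrow> real) \<Rightarrow> real" where
  "normV w = sqrt (ipD (wderiv w) (wderiv w))"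

text \<open>Riemann--Liouville derivative of order 2 - alpha of w in V:
  (1/Gamma(alpha-1)) * integral_0^x (x-t)^(alpha-2) w'(t) dt.\<close>
definition RLD :: "real \<Rightarrow> (real \<Rightarrow> real) \<Rightarrow> real \<Rightarrow> real" where
  "RLD \<alpha> w x = (1 / Gamma (\<alpha> - 1)) *
      (LINT t:{0<..<x}|lborel. (x - t) powr (\<alpha> - 2) * wderiv w t)"

definition form_a :: "(real \<Rightarrow> real) \<Rightarrow> (real \<Rightarrow> real) \<Rightarrow> real" where
  "form_a \<psi> \<phi> = ipD (wderiv \<psi>) (wderiv \<phi>)"

definition form_b :: "real \<Rightarrow> (real \<Rightarrow> real) \<Rightarrow> (real \<Rightarrow> real)
    \<Rightarrow> (real \<Rightarrow> real) \<Rightarrow> (real \<Rightarrow> real) \<Rightarrow> real" where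
  "form_b \<alpha> q p \<psi> \<phi> = ipD (RLD \<alpha> \<psi>) (\<lambda>x. q x * \<phi> x) + RLD \<alpha> \<psi> 1 * ipD p \<phi>"

definition form_A :: "real \<Rightarrow> (real \<Rightarrow> real) \<Rightarrow> (real \<Rightarrow> real)
    \<Rightarrow> (real \<Rightarrow> real) \<Rightarrow> (real \<Rightarrow> real) \<Rightarrow> real" where
  "form_A \<alpha> q p \<psi> \<phi> = form_a \<psi> \<phi> + form_b \<alpha> q p \<psi> \<phi>"

definition dualV :: "((real \<Rightarrow> real) \<Rightarrow> real) \<Rightarrow> bool" where
  "dualV F \<longleftrightarrow>
     (\<forall>u\<in>H10. \<forall>v\<in>H10. \<forall>a b. F (\<lambda>x. a * u x + b * v x) = a * F u + b * F v)
     \<and> (\<exists>C. \<forall>v\<in>H10. \<bar>F v\<bar> \<le> C * normV v)"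

end

theory Submission
  imports Defs "HOL-Probability.Probability_Measure"
begin

text \<open>Write \<open>g = w'\<close> and \<open>\<psi> = \<phi>'\<close>, both of mean zero. Integrating by parts moves the primitive
  off \<open>\<phi>\<close> and gives \<open>A(w, \<phi>) = (g - S g - (K g)(1) P, \<psi>)\<close>, where \<open>K g\<close> is the fractional derivative
  of \<open>w\<close>, \<open>S g\<close> is the primitive of \<open>q K g\<close> and \<open>P\<close> is the primitive of \<open>p\<close>. By the Riesz
  representation theorem \<open>F\<close> is \<open>\<phi> \<mapsto> (f, \<psi>)\<close> for some square-integrable \<open>f\<close>, so it suffices to solve
  \<open>g - S g = f + c + d P\<close> with a constant \<open>c\<close>, subject to \<open>\<integral> g = 0\<close> and \<open>d = (K g)(1)\<close>.
  Since \<open>S\<close> is a Volterra operator, it is a contraction in a sup norm with exponential weight,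
  so \<open>g - S g = h\<close> is solvable for every \<open>h\<close>. By superposition, only a
  linear system of two equations for \<open>c\<close> and \<open>d\<close> remains; hypothesis (a) makes it nonsingular.\<close>

section \<open>Square-integrable functions\<close>

definition sq_integrable :: "'a measure \<Rightarrow> ('a \<Rightarrow> real) \<Rightarrow> bool" where
  "sq_integrable M f \<longleftrightarrow> f \<in> borel_measurable M \<and> integrable M (\<lambda>x. (f x)\<^sup>2)"

lemma sq_integrable_measurable [dest]: "sq_integrable M f \<Longrightarrow> f \<in> borel_measurable M"
  by (simp add: sq_integrable_def)

lemma sq_integrable_square [dest]: "sq_integrable M f \<Longrightarrow> integrable M (\<lambda>x. (f x)\<^sup>2)"
  by (simp add: sq_integrable_def)

lemma sq_integrable_mult:
  assumes "sq_integrable M f" "sq_integrable M g"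
  shows "integrable M (\<lambda>x. f x * g x)"
proof (rule Bochner_Integration.integrable_bound)
  have [measurable]: "f \<in> borel_measurable M" "g \<in> borel_measurable M"
    using assms by auto
  show "integrable M (\<lambda>x. (f x)\<^sup>2 + (g x)\<^sup>2)"
    using assms by auto
  show "(\<lambda>x. f x * g x) \<in> borel_measurable M"
    by measurable
  have "\<bar>a * b\<bar> \<le> a\<^sup>2 + b\<^sup>2" for a b :: real
  proof -
    have "0 \<le> (\<bar>a\<bar> - \<bar>b\<bar>)\<^sup>2" by simp
    then have "2 * (\<bar>a\<bar> * \<bar>b\<bar>) \<le> a\<^sup>2 + b\<^sup>2"
      by (simp add: power2_diff)
    moreover have "0 \<le> \<bar>a\<bar> * \<bar>b\<bar>" by simp
    ultimately show ?thesis unfolding abs_mult by linarith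
  qed
  then show "AE x in M. norm (f x * g x) \<le> norm ((f x)\<^sup>2 + (g x)\<^sup>2)"
    by simp
qed

lemma sq_integrable_cmult:
  assumes "sq_integrable M f"
  shows "sq_integrable M (\<lambda>x. c * f x)"
  using assms by (auto simp: sq_integrable_def power_mult_distrib)

lemma sq_integrable_add:
  assumes "sq_integrable M f" "sq_integrable M g"
  shows "sq_integrable M (\<lambda>x. f x + g x)"
  using assms sq_integrable_mult[OF assms]
  by (auto simp: sq_integrable_def power2_sum mult.assoc)

lemma sq_integrable_lincomb:
  assumes "sq_integrable M f" "sq_integrable M g"
  shows "sq_integrable M (\<lambda>x. a * f x + b * g x)"
  using assms by (intro sq_integrable_add sq_integrable_cmult)

lemma sq_integrable_diff:
  assumes "sq_integrable M f" "sq_integrable M g"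
  shows "sq_integrable M (\<lambda>x. f x - g x)"
  using sq_integrable_lincomb[OF assms, of 1 "-1"] by simp

lemma sq_integrable_bounded:
  assumes "finite_measure M" "f \<in> borel_measurable M" "AE x in M. \<bar>f x\<bar> \<le> C"
  shows "sq_integrable M f"
proof -
  interpret finite_measure M by fact
  have "AE x in M. norm ((f x)\<^sup>2) \<le> C\<^sup>2"
    using assms(3)
  proof eventually_elim
    case (elim x)
    show ?case using power_mono[OF elim, of 2] by simp
  qed
  then have "integrable M (\<lambda>x. (f x)\<^sup>2)"
    using assms(2) by (intro integrable_const_bound) auto
  then show ?thesis using assms(2) by (simp add: sq_integrable_def)
qed

lemma sq_integrable_const: "finite_measure M \<Longrightarrow> sq_integrable M (\<lambda>x. c)"
  by (rule sq_integrable_bounded[where C="\<bar>c\<bar>"]) auto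

lemma sq_integrable_integrable:
  assumes "finite_measure M" "sq_integrable M f"
  shows "integrable M f"
  using sq_integrable_mult[OF assms(2) sq_integrable_const[OF assms(1), of 1]] by simp

lemma integral_square_lincomb:
  assumes "sq_integrable M f" "sq_integrable M g"
  shows "(\<integral>x. (a * f x + b * g x)\<^sup>2 \<partial>M) =
    a\<^sup>2 * (\<integral>x. (f x)\<^sup>2 \<partial>M) + 2 * a * b * (\<integral>x. f x * g x \<partial>M) + b\<^sup>2 * (\<integral>x. (g x)\<^sup>2 \<partial>M)"
proof -
  have "(\<integral>x. (a * f x + b * g x)\<^sup>2 \<partial>M) =
    (\<integral>x. a\<^sup>2 * (f x)\<^sup>2 + 2 * a * b * (f x * g x) + b\<^sup>2 * (g x)\<^sup>2 \<partial>M)"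
    by (intro Bochner_Integration.integral_cong) (auto simp: power2_eq_square algebra_simps)
  also have "\<dots> = a\<^sup>2 * (\<integral>x. (f x)\<^sup>2 \<partial>M) + 2 * a * b * (\<integral>x. f x * g x \<partial>M)
      + b\<^sup>2 * (\<integral>x. (g x)\<^sup>2 \<partial>M)"
    using assms sq_integrable_mult[OF assms] by (auto simp: sq_integrable_square)
  finally show ?thesis .
qed

text \<open>The integral of \<open>(s * f x + t * g x)^2\<close> is a quadratic form in
  \<open>s\<close> and \<open>t\<close> that is never negative. Taking \<open>s = c\<close> and
  \<open>t = - b\<close> gives \<open>0 \<le> c * (a * c - b^2)\<close>, which settles the case of
  nonzero \<open>c\<close>.\<close>

lemma Cauchy_Schwarz_integral:
  assumes "sq_integrable M f" "sq_integrable M g"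
  shows "\<bar>\<integral>x. f x * g x \<partial>M\<bar> \<le> sqrt (\<integral>x. (f x)\<^sup>2 \<partial>M) * sqrt (\<integral>x. (g x)\<^sup>2 \<partial>M)"
proof -
  define a b c where "a = (\<integral>x. (f x)\<^sup>2 \<partial>M)" "b = (\<integral>x. f x * g x \<partial>M)" "c = (\<integral>x. (g x)\<^sup>2 \<partial>M)"
  have nn: "0 \<le> a" "0 \<le> c" by (auto simp: a_b_c_def)
  have quad: "0 \<le> s\<^sup>2 * a + 2 * s * t * b + t\<^sup>2 * c" for s t
  proof -
    have "0 \<le> (\<integral>x. (s * f x + t * g x)\<^sup>2 \<partial>M)" by simp
    then show ?thesis
      unfolding integral_square_lincomb[OF assms, of s t] by (simp add: a_b_c_def)
  qed
  have "b\<^sup>2 \<le> a * c"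
  proof (cases "c = 0")
    case False
    have "0 \<le> c\<^sup>2 * a + 2 * c * (- b) * b + (- b)\<^sup>2 * c" by (rule quad)
    then have "0 \<le> c * (a * c - b\<^sup>2)" by (simp add: power2_eq_square algebra_simps)
    then show ?thesis using nn False by (simp add: zero_le_mult_iff)
  next
    case True
    have "b = 0"
    proof (rule ccontr)
      assume b: "b \<noteq> 0"
      \<comment> \<open>For \<open>c = 0\<close> and \<open>s = 1\<close> the form is affine in
        \<open>t\<close>; this value of \<open>t\<close> makes it equal to -1.\<close>
      have "0 \<le> a + 2 * (- (a + 1) / (2 * b)) * b"
        using quad[of 1 "- (a + 1) / (2 * b)"] True by simp
      then show False using b by (simp add: field_simps)
    qed
    then show ?thesis using nn by simp
  qed
  then have "sqrt (b\<^sup>2) \<le> sqrt (a * c)" by (rule real_sqrt_le_mono)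
  then show ?thesis by (simp add: a_b_c_def real_sqrt_mult)
qed

section \<open>Completeness of the square-integrable functions and the Riesz representation
  theorem\<close>

lemma integral_abs_le_L2:
  assumes "prob_space M" "sq_integrable M f"
  shows "(\<integral>x. \<bar>f x\<bar> \<partial>M) \<le> sqrt (\<integral>x. (f x)\<^sup>2 \<partial>M)"
proof -
  interpret prob_space M by fact
  have "sq_integrable M (\<lambda>x. \<bar>f x\<bar>)" using assms(2) by (auto simp: sq_integrable_def)
  from Cauchy_Schwarz_integral[OF this sq_integrable_const[of M 1]]
  show ?thesis by (simp add: prob_space finite_measure_axioms)
qed

text \<open>Riesz-Fischer for a prescribed geometric rate, which the minimizing sequence in
  \<open>L2_Riesz\<close> attains. The increments have summable integrals, so the sequence converges
  almost everywhere, and Fatou's lemma carries the Cauchy bound over to the limit.\<close>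

lemma L2_complete:
  assumes "prob_space M" and u: "\<And>n. sq_integrable M (u n)"
    and cauchy: "\<And>n m. n \<le> m \<Longrightarrow> (\<integral>x. (u m x - u n x)\<^sup>2 \<partial>M) \<le> (1/4)^n"
  obtains f where "sq_integrable M f" "\<And>n::nat. (\<integral>x. (u n x - f x)\<^sup>2 \<partial>M) \<le> (1/4)^n"
proof -
  interpret prob_space M by fact
  have [measurable]: "u n \<in> borel_measurable M" for n using u by auto
  \<comment> \<open>\<open>lim\<close> yields a measurable function defined everywhere; the points
    where the sequence diverges turn out to form a null set.\<close>
  define f where "f x = lim (\<lambda>n. u n x)" for x
  have [measurable]: "f \<in> borel_measurable M" unfolding f_def by measurable
  have sd: "sq_integrable M (\<lambda>x. u (Suc n) x - u n x)" for n by (intro sq_integrable_diff u)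
  have L1: "(\<integral>\<^sup>+x. ennreal \<bar>u (Suc n) x - u n x\<bar> \<partial>M) \<le> ennreal ((1/2)^n)" for n
  proof -
    have "(\<integral>\<^sup>+x. ennreal \<bar>u (Suc n) x - u n x\<bar> \<partial>M) = ennreal (\<integral>x. \<bar>u (Suc n) x - u n x\<bar> \<partial>M)"
      using sq_integrable_integrable[OF finite_measure_axioms sd]
      by (intro nn_integral_eq_integral) auto
    also have "(\<integral>x. \<bar>u (Suc n) x - u n x\<bar> \<partial>M) \<le> sqrt ((1/4)^n)"
      using integral_abs_le_L2[OF assms(1) sd] cauchy[of n "Suc n"]
      by (meson le_SucI order.refl order_trans real_sqrt_le_mono)
    also have "sqrt ((1/4)^n) = (1/2)^n"
      by (simp add: real_sqrt_power real_sqrt_divide)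
    finally show ?thesis by (simp add: ennreal_leI)
  qed
  have "(\<integral>\<^sup>+x. (\<Sum>n. ennreal \<bar>u (Suc n) x - u n x\<bar>) \<partial>M) = (\<Sum>n. \<integral>\<^sup>+x. ennreal \<bar>u (Suc n) x - u n x\<bar> \<partial>M)"
    by (intro nn_integral_suminf) auto
  also have "\<dots> \<le> (\<Sum>n. ennreal ((1/2)^n))"
    by (intro suminf_le L1) auto
  also have "\<dots> < \<infinity>"
    by (subst suminf_ennreal2) (auto intro: summable_geometric)
  finally have "AE x in M. (\<Sum>n. ennreal \<bar>u (Suc n) x - u n x\<bar>) \<noteq> \<infinity>"
    by (intro nn_integral_PInf_AE) auto
  then have lim: "AE x in M. (\<lambda>n. u n x) \<longlonglongrightarrow> f x"
  proof eventually_elim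
    case (elim x)
    have "summable (\<lambda>n. \<bar>u (Suc n) x - u n x\<bar>)"
      using elim by (intro summable_suminf_not_top) auto
    then have "summable (\<lambda>n. u (Suc n) x - u n x)"
      by (rule summable_rabs_cancel)
    then have "convergent (\<lambda>n. u n x - u 0 x)"
      by (simp only: summable_iff_convergent sum_lessThan_telescope[of "\<lambda>n. u n x"])
    then have "convergent (\<lambda>n. u n x)"
      by (simp only: convergent_diff_const_right_iff)
    then show ?case unfolding f_def by (simp add: convergent_LIMSEQ_iff)
  qed
  have bound: "(\<integral>\<^sup>+x. ennreal ((u n x - f x)\<^sup>2) \<partial>M) \<le> ennreal ((1/4)^n)" for n
  proof -
    have "(\<integral>\<^sup>+x. ennreal ((u n x - f x)\<^sup>2) \<partial>M) =
        (\<integral>\<^sup>+x. liminf (\<lambda>m. ennreal ((u m x - u n x)\<^sup>2)) \<partial>M)"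
    proof (intro nn_integral_cong_AE)
      show "AE x in M. ennreal ((u n x - f x)\<^sup>2) = liminf (\<lambda>m. ennreal ((u m x - u n x)\<^sup>2))"
        using lim
      proof eventually_elim
        case (elim x)
        have "(\<lambda>m. ennreal ((u m x - u n x)\<^sup>2)) \<longlonglongrightarrow> ennreal ((f x - u n x)\<^sup>2)"
          by (intro tendsto_intros elim)
        then show ?case using lim_imp_Liminf[OF sequentially_bot]
          by (metis power2_commute)
      qed
    qed
    also have "\<dots> \<le> liminf (\<lambda>m. \<integral>\<^sup>+x. ennreal ((u m x - u n x)\<^sup>2) \<partial>M)"
      by (intro nn_integral_liminf) auto
    also have "\<dots> \<le> ennreal ((1/4)^n)"
    proof -
      have "eventually (\<lambda>m. (\<integral>\<^sup>+x. ennreal ((u m x - u n x)\<^sup>2) \<partial>M) \<le> ennreal ((1/4)^n)) sequentially"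
        using eventually_ge_at_top[of n]
      proof eventually_elim
        case (elim m)
        have "(\<integral>\<^sup>+x. ennreal ((u m x - u n x)\<^sup>2) \<partial>M) = ennreal (\<integral>x. (u m x - u n x)\<^sup>2 \<partial>M)"
          using sq_integrable_diff[OF u u] by (intro nn_integral_eq_integral) auto
        then show ?case using cauchy[OF elim] by (simp add: ennreal_leI)
      qed
      then show ?thesis
        by (intro Liminf_le) (auto intro: eventually_frequently)
    qed
    finally show ?thesis .
  qed
  have int: "integrable M (\<lambda>x. (u n x - f x)\<^sup>2)" for n
    using bound[of n] by (intro integrableI_nonneg) (auto simp: less_top[symmetric] top_unique)
  have "sq_integrable M (\<lambda>x. u 0 x - f x)"
    using int by (auto simp: sq_integrable_def)
  \<comment> \<open>Here \<open>f = u 0 - (u 0 - f)\<close>.\<close>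
  from sq_integrable_diff[OF u[of 0] this] have "sq_integrable M f" by simp
  moreover have "(\<integral>x. (u n x - f x)\<^sup>2 \<partial>M) \<le> (1/4)^n" for n
  proof -
    have "ennreal (\<integral>x. (u n x - f x)\<^sup>2 \<partial>M) \<le> ennreal ((1/4)^n)"
      using bound[of n] int by (subst nn_integral_eq_integral[symmetric]) auto
    then show ?thesis by (simp add: ennreal_le_iff)
  qed
  ultimately show ?thesis using that by blast
qed

text \<open>Direct method: the functional \<open>J v = N v - 2 * L v\<close> is bounded below by
  completing the square. The parallelogram law makes a minimizing sequence Cauchy, and the vanishing
  first variation at its limit \<open>f\<close> in direction \<open>v\<close> is the identity
  \<open>L v = (f, v)\<close>.\<close>

lemma L2_Riesz:
  assumes "prob_space M"
    and lin: "\<And>u v a b. sq_integrable M u \<Longrightarrow> sq_integrable M v \<Longrightarrow>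
        L (\<lambda>x. a * u x + b * v x) = a * L u + b * L v"
    and bdd: "\<And>u. sq_integrable M u \<Longrightarrow> \<bar>L u\<bar> \<le> C * sqrt (\<integral>x. (u x)\<^sup>2 \<partial>M)"
  obtains f where "sq_integrable M f" "\<And>v. sq_integrable M v \<Longrightarrow> L v = (\<integral>x. f x * v x \<partial>M)"
proof -
  interpret prob_space M by fact
  define N where "N v = (\<integral>x. (v x)\<^sup>2 \<partial>M)" for v :: "'a \<Rightarrow> real"
  define J where "J v = N v - 2 * L v" for v
  let ?S = "Collect (sq_integrable M)"
  have N0: "0 \<le> N v" for v by (simp add: N_def)
  have J_ge: "- (C\<^sup>2) \<le> J v" if "v \<in> ?S" for v
  proof -
    have "0 \<le> (sqrt (N v) - C)\<^sup>2" by simp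
    then have "0 \<le> N v - 2 * (C * sqrt (N v)) + C\<^sup>2"
      using N0[of v] by (simp add: power2_diff mult_ac)
    then show ?thesis using bdd[of v] that unfolding J_def N_def by auto
  qed
  have bddJ: "bdd_below (J ` ?S)" using J_ge by (intro bdd_belowI2) auto
  have ne: "J ` ?S \<noteq> {}" using sq_integrable_const[OF finite_measure_axioms] by blast
  define m where "m = Inf (J ` ?S)"
  have m_le: "m \<le> J v" if "sq_integrable M v" for v
    unfolding m_def using bddJ that by (intro cInf_lower) auto
  \<comment> \<open>The parallelogram law multiplies the sum of two gaps by 2, so a quarter of
    \<open>(1/4)^n\<close> is exactly what the rate in \<open>L2_complete\<close> asks for.\<close>
  have "\<exists>v. sq_integrable M v \<and> J v < m + (1/4)^n / 4" for n :: nat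
    using cInf_lessD[OF ne, of "m + (1/4)^n / 4"] unfolding m_def by auto
  then obtain u where u: "\<And>n. sq_integrable M (u n)"
    and Ju: "\<And>n::nat. J (u n) < m + (1/4)^n / 4"
    by metis
  have cauchy: "(\<integral>x. (u k x - u n x)\<^sup>2 \<partial>M) \<le> (1/4)^n" if "n \<le> k" for n k
  proof -
    \<comment> \<open>In the combination \<open>2 * J (u k) + 2 * J (u n) - 4 * J ?mid\<close> the
      linear terms cancel, and what remains is the squared distance of \<open>u k\<close> and
      \<open>u n\<close>.\<close>
    let ?mid = "\<lambda>x. (1/2) * u k x + (1/2) * u n x"
    have "m \<le> J ?mid" by (intro m_le sq_integrable_lincomb u)
    moreover have "N ?mid = (1/4) * N (u k) + (1/2) * (\<integral>x. u k x * u n x \<partial>M) + (1/4) * N (u n)"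
      unfolding N_def integral_square_lincomb[OF u u] by (simp add: power2_eq_square)
    moreover have "L ?mid = L (u k) / 2 + L (u n) / 2"
      unfolding lin[OF u u] by simp
    moreover have "(\<integral>x. (u k x - u n x)\<^sup>2 \<partial>M) = N (u k) - 2 * (\<integral>x. u k x * u n x \<partial>M) + N (u n)"
      using integral_square_lincomb[OF u u, of 1 k "-1" n] by (simp add: N_def)
    moreover have "(1/4::real)^k \<le> (1/4)^n"
      using that by (intro power_decreasing) auto
    ultimately show ?thesis using Ju[of k] Ju[of n] unfolding J_def by linarith
  qed
  obtain f where f: "sq_integrable M f" and uf: "\<And>n. (\<integral>x. (u n x - f x)\<^sup>2 \<partial>M) \<le> (1/4)^n"
    using L2_complete[OF assms(1) u cauchy] by blast
  have "L v = (\<integral>x. f x * v x \<partial>M)" if v: "sq_integrable M v" for v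
  proof -
    define r where "r n = (\<integral>x. u n x * v x \<partial>M)" for n
    have "\<bar>r n - (\<integral>x. f x * v x \<partial>M)\<bar> \<le> (1/2)^n * sqrt (N v)" for n
    proof -
      have eq: "r n - (\<integral>x. f x * v x \<partial>M) = (\<integral>x. (u n x - f x) * v x \<partial>M)"
        unfolding r_def left_diff_distrib
        by (rule Bochner_Integration.integral_diff[symmetric, OF sq_integrable_mult[OF u v] sq_integrable_mult[OF f v]])
      have "\<bar>r n - (\<integral>x. f x * v x \<partial>M)\<bar> \<le> sqrt (\<integral>x. (u n x - f x)\<^sup>2 \<partial>M) * sqrt (N v)"
        unfolding N_def eq by (rule Cauchy_Schwarz_integral[OF sq_integrable_diff[OF u f] v])
      also have "\<dots> \<le> sqrt ((1/4)^n) * sqrt (N v)"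
        by (rule mult_right_mono[OF real_sqrt_le_mono[OF uf]]) (simp add: N0)
      also have "sqrt ((1/4)^n) = (1/2)^n"
        by (simp add: real_sqrt_power real_sqrt_divide)
      finally show ?thesis .
    qed
    then have rlim: "\<forall>n. \<bar>r n - (\<integral>x. f x * v x \<partial>M)\<bar> \<le> (1/2)^n * sqrt (N v)" by blast
    have "(\<lambda>n. (1/2)^n * sqrt (N v)) \<longlonglongrightarrow> 0"
      by (rule tendsto_mult_left_zero[OF LIMSEQ_power_zero]) simp
    then have "(\<lambda>n. r n - (\<integral>x. f x * v x \<partial>M)) \<longlonglongrightarrow> 0"
      by (rule Lim_null_comparison[rotated]) (rule always_eventually, unfold real_norm_def, rule rlim)
    then have lim: "r \<longlonglongrightarrow> (\<integral>x. f x * v x \<partial>M)"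
      by (rule LIM_zero_cancel)
    define e where "e = (\<integral>x. f x * v x \<partial>M) - L v"
    have quad: "0 \<le> 2 * t * e + t\<^sup>2 * N v" for t
    proof (rule tendsto_lowerbound[OF _ always_eventually])
      show "(\<lambda>n. (1/4)^n / 4 + (2 * t * (r n - L v) + t\<^sup>2 * N v)) \<longlonglongrightarrow> 2 * t * e + t\<^sup>2 * N v"
      proof -
        have "(\<lambda>n. (1/4)^n / 4 :: real) \<longlonglongrightarrow> 0 / 4"
          by (intro tendsto_divide LIMSEQ_power_zero tendsto_const) auto
        moreover have "(\<lambda>n. 2 * t * (r n - L v) + t\<^sup>2 * N v) \<longlonglongrightarrow> 2 * t * e + t\<^sup>2 * N v"
          unfolding e_def by (intro tendsto_add tendsto_mult tendsto_diff tendsto_const lim)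
        ultimately show ?thesis using tendsto_add by fastforce
      qed
      show "\<forall>n. 0 \<le> (1/4)^n / 4 + (2 * t * (r n - L v) + t\<^sup>2 * N v)"
      proof
        fix n
        let ?w = "\<lambda>x. 1 * u n x + t * v x"
        have "m \<le> J ?w" by (intro m_le sq_integrable_lincomb u v)
        also have "J ?w = J (u n) + 2 * t * (r n - L v) + t\<^sup>2 * N v"
          unfolding J_def N_def r_def integral_square_lincomb[OF u[of n] v, of 1 t]
            lin[OF u[of n] v, of 1 t]
          by (simp add: right_diff_distrib)
        finally show "0 \<le> (1/4)^n / 4 + (2 * t * (r n - L v) + t\<^sup>2 * N v)"
          using Ju[of n] by simp
      qed
    qed simp
    have "e = 0"
    proof (rule ccontr)
      assume "e \<noteq> 0"
      \<comment> \<open>For small \<open>t\<close> the linear term wins. The choice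
        \<open>t = - s\<close> turns the form into \<open>- (s^2 * (N v + 2))\<close>, and the added
        1 keeps the denominator positive.\<close>
      define s where "s = e / (N v + 1)"
      have e: "e = s * (N v + 1)" and "s \<noteq> 0"
        using N0[of v] \<open>e \<noteq> 0\<close> by (auto simp: s_def)
      have "0 \<le> 2 * (- s) * e + (- s)\<^sup>2 * N v" by (rule quad)
      also have "\<dots> = - (s\<^sup>2 * (N v + 2))"
        unfolding e by (simp add: power2_eq_square algebra_simps)
      also have "\<dots> < 0"
        using N0[of v] \<open>s \<noteq> 0\<close> by simp
      finally show False by simp
    qed
    then show ?thesis by (simp add: e_def)
  qed
  with f show ?thesis using that by blast
qed

section \<open>Primitives on the unit interval\<close>

definition lebD :: "real measure" where
  "lebD = restrict_space lborel {0<..<1}"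

lemma space_lebD [simp]: "space lebD = {0<..<1}"
  by (simp add: lebD_def space_restrict_space)

lemma prob_space_lebD: "prob_space lebD"
  by (rule prob_spaceI) (simp add: lebD_def space_restrict_space emeasure_restrict_space)

interpretation lebD: prob_space lebD
  by (rule prob_space_lebD)

interpretation lebD2: pair_sigma_finite lebD lebD ..

lemma ident_measurable_lebD [measurable]: "(\<lambda>x. x) \<in> borel_measurable lebD"
  unfolding lebD_def by (intro measurable_restrict_space1) simp

lemma borel_measurable_lebD_I: "f \<in> borel_measurable borel \<Longrightarrow> f \<in> borel_measurable lebD"
  unfolding lebD_def by (intro measurable_restrict_space1) simp

lemma integral_lebD: "(\<integral>x. f x \<partial>lebD) = (LINT x:{0<..<1}|lborel. f x)"
  for f :: "real \<Rightarrow> real"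
  unfolding lebD_def set_lebesgue_integral_def by (simp add: integral_restrict_space)

lemma L2D_iff: "L2D f \<longleftrightarrow> sq_integrable lebD f"
  unfolding L2D_def sq_integrable_def lebD_def set_borel_measurable_def set_integrable_def
  by (simp add: borel_measurable_restrict_space_iff integrable_restrict_space)

lemma AE_lebD: "(AE x in lebD. P x) \<longleftrightarrow> (AE x in lborel. x \<in> {0<..<1} \<longrightarrow> P x)"
  unfolding lebD_def by (subst AE_restrict_space_iff) auto

lemma LinfD_iff: "LinfD f \<longleftrightarrow> f \<in> borel_measurable lebD \<and> (\<exists>C. AE x in lebD. \<bar>f x\<bar> \<le> C)"
  unfolding LinfD_def AE_lebD set_borel_measurable_def
  by (simp add: lebD_def borel_measurable_restrict_space_iff)

lemma ipD_eq: "ipD f g = (\<integral>x. f x * g x \<partial>lebD)"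
  by (simp add: ipD_def integral_lebD)

lemma set_integral_lebD:
  fixes f :: "real \<Rightarrow> real"
  assumes "x \<in> {0..1}"
  shows "(LINT t:{0<..<x}|lborel. f t) = (\<integral>t. indicator {..<x} t * f t \<partial>lebD)"
  unfolding integral_lebD set_lebesgue_integral_def
  using assms by (intro Bochner_Integration.integral_cong) (auto split: split_indicator)

text \<open>The indicator, in place of a set integral, keeps the integration over
  \<open>lebD\<close>, so that measurability in \<open>t\<close> follows from joint measurability.
  The primitive is defined for every real \<open>t\<close>: it vanishes for \<open>t \<le> 0\<close>
  and is constant for \<open>t \<ge> 1\<close>.\<close>

definition prim :: "(real \<Rightarrow> real) \<Rightarrow> real \<Rightarrow> real" where
  "prim h t = (\<integral>s. indicator {..<t} s * h s \<partial>lebD)"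

lemma integrable_indicator_lebD:
  "integrable lebD h \<Longrightarrow> integrable lebD (\<lambda>s. indicator {..<t} s * h s)" for h :: "real \<Rightarrow> real"
  using integrable_mult_indicator[of "{0<..<1} \<inter> {..<t}" lebD h]
  by (subst Bochner_Integration.integrable_cong[OF refl, of _ _ "\<lambda>s. indicator ({0<..<1} \<inter> {..<t}) s *\<^sub>R h s"])
    (auto simp: lebD_def sets_restrict_space split: split_indicator)

lemma prim_lincomb:
  assumes "integrable lebD f" "integrable lebD g"
  shows "prim (\<lambda>x. a * f x + b * g x) t = a * prim f t + b * prim g t"
proof -
  have "prim (\<lambda>x. a * f x + b * g x) t =
    (\<integral>s. a * (indicator {..<t} s * f s) + b * (indicator {..<t} s * g s) \<partial>lebD)"
    unfolding prim_def by (intro Bochner_Integration.integral_cong) (auto simp: algebra_simps)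
  then show ?thesis
    using assms by (simp add: prim_def integrable_indicator_lebD)
qed

lemma abs_prim_le:
  assumes "integrable lebD h"
  shows "\<bar>prim h t\<bar> \<le> (\<integral>x. \<bar>h x\<bar> \<partial>lebD)"
proof -
  have "\<bar>prim h t\<bar> \<le> (\<integral>s. \<bar>indicator {..<t} s * h s\<bar> \<partial>lebD)"
    unfolding prim_def by (rule integral_abs_bound)
  also have "\<dots> \<le> (\<integral>x. \<bar>h x\<bar> \<partial>lebD)"
    using assms integrable_indicator_lebD[OF assms, of t]
    by (intro integral_mono integrable_abs) (auto split: split_indicator)
  finally show ?thesis .
qed

lemma indicator_less_measurable [measurable]:
  "(\<lambda>(t, s). indicator {..<t} s :: real) \<in> borel_measurable (lebD \<Otimes>\<^sub>M lebD)"
proof -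
  have "(\<lambda>(t, s). indicator {..<t} s :: real) = (\<lambda>z. if snd z < fst z then 1 else 0)"
    by (auto split: split_indicator)
  also have "\<dots> \<in> borel_measurable (lebD \<Otimes>\<^sub>M lebD)"
    by (rule measurable_If) (auto intro!: borel_measurable_less measurable_compose[OF measurable_fst ident_measurable_lebD] measurable_compose[OF measurable_snd ident_measurable_lebD])
  finally show ?thesis .
qed

lemma prim_measurable [measurable]:
  assumes [measurable]: "h \<in> borel_measurable lebD"
  shows "prim h \<in> borel_measurable lebD"
  unfolding prim_def by (rule lebD.borel_measurable_lebesgue_integral) measurable

lemma sq_integrable_prim:
  assumes "integrable lebD h"
  shows "sq_integrable lebD (prim h)"
  using assms abs_prim_le[OF assms]
  by (intro sq_integrable_bounded[OF lebD.finite_measure_axioms]) auto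

text \<open>Fubini on the triangle \<open>t < x\<close> of the unit square: with the order
  exchanged, \<open>g t\<close> is multiplied by the integral of \<open>h\<close> over
  \<open>x > t\<close>, which is the full integral minus \<open>prim h t\<close>.\<close>

lemma integral_prim_by_parts:
  assumes h: "integrable lebD h" and g: "integrable lebD g"
  shows "(\<integral>x. h x * prim g x \<partial>lebD) = (\<integral>x. h x \<partial>lebD) * (\<integral>x. g x \<partial>lebD) - (\<integral>x. g x * prim h x \<partial>lebD)"
proof -
  have [measurable]: "h \<in> borel_measurable lebD" "g \<in> borel_measurable lebD"
    using h g by auto
  have hg: "integrable (lebD \<Otimes>\<^sub>M lebD) (\<lambda>(x, t). h x * g t)"
  proof (rule lebD2.Fubini_integrable)
    show "integrable lebD (\<lambda>x. \<integral>y. norm (case (x, y) of (x, t) \<Rightarrow> h x * g t) \<partial>lebD)"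
      using h g by (simp add: abs_mult)
    show "AE x in lebD. integrable lebD (\<lambda>y. case (x, y) of (x, t) \<Rightarrow> h x * g t)"
      using g by simp
  qed measurable
  have int: "integrable (lebD \<Otimes>\<^sub>M lebD) (\<lambda>(x, t). h x * (indicator {..<x} t * g t))"
    by (rule Bochner_Integration.integrable_bound[OF hg]) (auto split: split_indicator)
  have "(\<integral>x. h x * prim g x \<partial>lebD) = (\<integral>x. (\<integral>t. h x * (indicator {..<x} t * g t) \<partial>lebD) \<partial>lebD)"
    by (simp add: prim_def)
  also have "\<dots> = (\<integral>t. (\<integral>x. h x * (indicator {..<x} t * g t) \<partial>lebD) \<partial>lebD)"
    using lebD2.Fubini_integral[OF int] by simp
  also have "\<dots> = (\<integral>t. g t * ((\<integral>x. h x \<partial>lebD) - prim h t) \<partial>lebD)"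
  proof (intro Bochner_Integration.integral_cong refl)
    fix t
    have "(\<integral>x. h x * (indicator {..<x} t * g t) \<partial>lebD) = (\<integral>x. g t * (h x - indicator {..<t} x * h x) \<partial>lebD)"
    proof (rule integral_cong_AE)
      \<comment> \<open>Both indicators are strict, so \<open>indicator {..<x} t\<close> and
        \<open>1 - indicator {..<t} x\<close> disagree at \<open>x = t\<close> and nowhere
        else.\<close>
      have "AE x in lebD. x \<noteq> t"
        unfolding AE_lebD using AE_lborel_singleton[of t] by eventually_elim simp
      then show "AE x in lebD. h x * (indicator {..<x} t * g t) = g t * (h x - indicator {..<t} x * h x)"
        by eventually_elim (auto split: split_indicator)
      have "(\<lambda>x. indicator {..<x} t :: real) = indicator {t<..}"
        by (auto split: split_indicator)
      then have [measurable]: "(\<lambda>x. indicator {..<x} t :: real) \<in> borel_measurable lebD"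
        by (auto intro!: borel_measurable_lebD_I)
      show "(\<lambda>x. h x * (indicator {..<x} t * g t)) \<in> borel_measurable lebD" by measurable
      have [measurable]: "(\<lambda>x. indicator {..<t} x :: real) \<in> borel_measurable lebD"
        by (intro borel_measurable_lebD_I) simp
      show "(\<lambda>x. g t * (h x - indicator {..<t} x * h x)) \<in> borel_measurable lebD" by measurable
    qed
    also have "\<dots> = g t * ((\<integral>x. h x \<partial>lebD) - prim h t)"
      using h integrable_indicator_lebD[OF h] by (simp add: prim_def)
    finally show "(\<integral>x. h x * (indicator {..<x} t * g t) \<partial>lebD) = \<dots>" .
  qed
  also have "\<dots> = (\<integral>x. h x \<partial>lebD) * (\<integral>x. g x \<partial>lebD) - (\<integral>x. g x * prim h x \<partial>lebD)"
  proof -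
    have "integrable lebD (\<lambda>x. g x * prim h x)"
    proof (rule Bochner_Integration.integrable_bound[of lebD "\<lambda>x. (\<integral>x. \<bar>h x\<bar> \<partial>lebD) * g x"])
      show "AE x in lebD. norm (g x * prim h x) \<le> norm ((\<integral>x. \<bar>h x\<bar> \<partial>lebD) * g x)"
        using abs_prim_le[OF h]
        by (intro AE_I2) (auto simp: abs_mult mult.commute intro!: mult_left_mono)
    qed (use g in auto)
    then show ?thesis using g by (simp add: right_diff_distrib mult.commute)
  qed
  finally show ?thesis .
qed

lemma abs_prim_diff_le:
  assumes "h \<in> borel_measurable lebD" and B: "AE x in lebD. \<bar>h x\<bar> \<le> B"
  shows "\<bar>prim h t - prim h s\<bar> \<le> B * \<bar>t - s\<bar>"
proof -
  have *: "\<bar>prim h t - prim h s\<bar> \<le> B * (t - s)" if "s \<le> t" for s t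
  proof -
    have h: "integrable lebD h"
      using assms by (intro lebD.integrable_const_bound) auto
    have "prim h t - prim h s = (\<integral>x. indicator {..<t} x * h x - indicator {..<s} x * h x \<partial>lebD)"
      unfolding prim_def using integrable_indicator_lebD[OF h] by simp
    also have "\<bar>\<dots>\<bar> \<le> (\<integral>x. \<bar>indicator {..<t} x * h x - indicator {..<s} x * h x\<bar> \<partial>lebD)"
      by (rule integral_abs_bound)
    also have "\<dots> \<le> (\<integral>x. B * indicator ({0<..<1} \<inter> {s..<t}) x \<partial>lebD)"
    proof (rule integral_mono_AE)
      show "integrable lebD (\<lambda>x. \<bar>indicator {..<t} x * h x - indicator {..<s} x * h x\<bar>)"
        using integrable_indicator_lebD[OF h] by auto
      show "integrable lebD (\<lambda>x. B * indicator ({0<..<1} \<inter> {s..<t}) x)"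
        by (intro integrable_mult_right) (auto simp: lebD_def sets_restrict_space lebD.emeasure_finite[unfolded lebD_def] less_top[symmetric])
      show "AE x in lebD. \<bar>indicator {..<t} x * h x - indicator {..<s} x * h x\<bar> \<le> B * indicator ({0<..<1} \<inter> {s..<t}) x"
        using B AE_space by eventually_elim (use that in \<open>auto split: split_indicator\<close>)
    qed
    also have "\<dots> = B * measure lebD ({0<..<1} \<inter> {s..<t})"
      by (simp add: Int_ac)
    also have "\<dots> \<le> B * (t - s)"
    proof (rule mult_left_mono)
      have "{s..<t} \<in> fmeasurable lborel" using that by (simp add: fmeasurable_def)
      then have "measure lborel ({0<..<1} \<inter> {s..<t}) \<le> measure lborel {s..<t}"
        by (intro measure_mono_fmeasurable) auto
      moreover have "measure lebD ({0<..<1} \<inter> {s..<t}) = measure lborel ({0<..<1} \<inter> {s..<t})"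
        unfolding lebD_def by (rule measure_restrict_space) auto
      ultimately have "measure lebD ({0<..<1} \<inter> {s..<t}) \<le> measure lborel {s..<t}"
        by simp
      then show "measure lebD ({0<..<1} \<inter> {s..<t}) \<le> t - s" using that by simp
      have "AE x in lebD. 0 \<le> B" using B by eventually_elim auto
      then show "0 \<le> B" by simp
    qed
    finally show ?thesis .
  qed
  show ?thesis
    using *[of s t] *[of t s] by (cases "s \<le> t") (auto simp: abs_minus_commute)
qed

lemma continuous_on_prim:
  assumes "h \<in> borel_measurable lebD" "AE x in lebD. \<bar>h x\<bar> \<le> B"
  shows "continuous_on A (prim h)"
proof -
  have "AE x in lebD. 0 \<le> B" using assms(2) by eventually_elim auto
  then have "B-lipschitz_on A (prim h)"
    using abs_prim_diff_le[OF assms] by (intro lipschitz_onI) (auto simp: dist_real_def)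
  then show ?thesis by (rule lipschitz_on_continuous_on)
qed

text \<open>The factor \<open>1 / l\<close> gained by integrating the weight is the source of the
  contraction for large \<open>l\<close>.\<close>

lemma prim_exp_le:
  assumes "0 < l" "t \<in> {0..1}"
  shows "prim (\<lambda>s. exp (l * s)) t \<le> exp (l * t) / l"
proof -
  have "((\<lambda>s. exp (l * s)) has_integral (exp (l * t) / l - exp (l * 0) / l)) {0..t}"
    using assms
    by (intro fundamental_theorem_of_calculus)
      (auto intro!: derivative_eq_intros simp flip: has_real_derivative_iff_has_vector_derivative)
  then have "integral {0..t} (\<lambda>s. exp (l * s)) = exp (l * t) / l - 1 / l"
    by (auto dest!: integral_unique)
  moreover have "set_integrable lborel {0..t} (\<lambda>s. exp (l * s))"
    by (intro borel_integrable_atLeastAtMost') (auto intro!: continuous_intros)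
  ultimately have "(LINT s:{0..t}|lborel. exp (l * s)) = exp (l * t) / l - 1 / l"
    by (simp add: set_borel_integral_eq_integral)
  moreover have "(LINT s:{0<..<t}|lborel. exp (l * s)) \<le> (LINT s:{0..t}|lborel. exp (l * s))"
    using \<open>set_integrable lborel {0..t} (\<lambda>s. exp (l * s))\<close>
    unfolding set_lebesgue_integral_def set_integrable_def
    by (intro integral_mono) (auto split: split_indicator intro!:
      Bochner_Integration.integrable_bound[OF \<open>set_integrable lborel {0..t} (\<lambda>s. exp (l * s))\<close>[unfolded set_integrable_def]])
  moreover have "0 \<le> 1 / l" using assms by simp
  ultimately show ?thesis
    unfolding set_integral_lebD[OF assms(2)] prim_def by linarith
qed

text \<open>The positive and negative parts of \<open>g\<close>, extended by zero, are densities of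
  two finite measures. A vanishing primitive makes these agree on every half-line, hence as
  measures, so the two densities coincide almost everywhere. This is what makes weak derivatives
  unique.\<close>

lemma prim_eq_0_imp_AE:
  assumes g: "integrable lebD g" and 0: "\<And>x. x \<in> {0..1} \<Longrightarrow> prim g x = 0"
  shows "AE x in lebD. g x = 0"
proof -
  define G where "G x = indicator {0<..<1} x * g x" for x
  have G: "integrable lborel G"
    using g by (simp add: lebD_def integrable_restrict_space G_def[abs_def])
  then have [measurable]: "G \<in> borel_measurable borel" by simp
  have int0: "(\<integral>x. indicator {a<..} x * G x \<partial>lborel) = 0" for a
  proof -
    have IG: "integrable lborel (\<lambda>x. indicator {..a} x * G x)"
      using integrable_mult_indicator[OF _ G, of "{..a}"] by simp
    have prim': "(\<integral>x. indicator {..<b} x * G x \<partial>lborel) = prim g b" for b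
      unfolding prim_def integral_lebD set_lebesgue_integral_def G_def
      by (simp add: mult_ac)
    have all: "prim g b = 0" for b
    proof -
      consider "b \<le> 0" | "b \<in> {0..1}" | "b \<ge> 1" by force
      then show ?thesis
      proof cases
        case 1
        then have "prim g b = (\<integral>s. 0 \<partial>lebD)"
          unfolding prim_def by (intro Bochner_Integration.integral_cong) (auto split: split_indicator)
        then show ?thesis by simp
      next
        case 3
        then have "prim g b = prim g 1"
          unfolding prim_def by (intro Bochner_Integration.integral_cong) (auto split: split_indicator)
        then show ?thesis using 0 by simp
      qed (use 0 in auto)
    qed
    \<comment> \<open>The bound 2 lies beyond the support of \<open>G\<close>, so
      \<open>{..<2}\<close> captures the full integral; the only discrepancy is at the null set
      \<open>{a}\<close>.\<close>
    have "(\<integral>x. indicator {a<..} x * G x \<partial>lborel) = (\<integral>x. indicator {..<2} x * G x - indicator {..<a} x * G x \<partial>lborel)"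
    proof (rule integral_cong_AE)
      show "AE x in lborel. indicator {a<..} x * G x = indicator {..<2} x * G x - indicator {..<a} x * G x"
        using AE_lborel_singleton[of a] by eventually_elim (auto split: split_indicator simp: G_def)
    qed auto
    also have "\<dots> = prim g 2 - prim g a"
      unfolding prim'[symmetric] using integrable_mult_indicator[OF _ G]
      by (intro Bochner_Integration.integral_diff) auto
    finally show ?thesis using all by simp
  qed
  have pn: "integrable lborel (\<lambda>x. max 0 (G x))" "integrable lborel (\<lambda>x. max 0 (- G x))"
    using G by auto
  have eq: "(\<integral>\<^sup>+x. ennreal (max 0 (G x)) * indicator {a<..} x \<partial>lborel) = (\<integral>\<^sup>+x. ennreal (max 0 (- G x)) * indicator {a<..} x \<partial>lborel)" for a
  proof -
    have i: "integrable lborel (\<lambda>x. indicator {a<..} x * max 0 (G x))"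
       "integrable lborel (\<lambda>x. indicator {a<..} x * max 0 (- G x))"
      using integrable_mult_indicator[OF _ pn(1), of "{a<..}"] integrable_mult_indicator[OF _ pn(2), of "{a<..}"] by auto
    have "(\<integral>x. indicator {a<..} x * max 0 (G x) \<partial>lborel) - (\<integral>x. indicator {a<..} x * max 0 (- G x) \<partial>lborel)
       = (\<integral>x. indicator {a<..} x * max 0 (G x) - indicator {a<..} x * max 0 (- G x) \<partial>lborel)"
      using i by simp
    also have "\<dots> = (\<integral>x. indicator {a<..} x * G x \<partial>lborel)"
      by (intro Bochner_Integration.integral_cong) (auto split: split_indicator simp: max_def)
    finally have e: "(\<integral>x. indicator {a<..} x * max 0 (G x) \<partial>lborel) = (\<integral>x. indicator {a<..} x * max 0 (- G x) \<partial>lborel)"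
      using int0 by simp
    have "(\<integral>\<^sup>+x. ennreal (max 0 (G x)) * indicator {a<..} x \<partial>lborel) = (\<integral>\<^sup>+x. ennreal (indicator {a<..} x * max 0 (G x)) \<partial>lborel)"
      by (intro nn_integral_cong) (auto split: split_indicator)
    also have "\<dots> = (\<integral>\<^sup>+x. ennreal (indicator {a<..} x * max 0 (- G x)) \<partial>lborel)"
      using i e by (simp add: nn_integral_eq_integral)
    also have "\<dots> = (\<integral>\<^sup>+x. ennreal (max 0 (- G x)) * indicator {a<..} x \<partial>lborel)"
      by (intro nn_integral_cong) (auto split: split_indicator)
    finally show ?thesis .
  qed
  have fin: "(\<integral>\<^sup>+x. ennreal (max 0 (G x)) \<partial>lborel) \<noteq> \<infinity>"
    using pn(1) by (simp add: nn_integral_eq_integral)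
  have "density lborel (\<lambda>x. ennreal (max 0 (G x))) = density lborel (\<lambda>x. ennreal (max 0 (- G x)))"
  proof (rule measure_eqI_lessThan)
    fix a
    show "emeasure (density lborel (\<lambda>x. ennreal (max 0 (G x)))) {a<..} = emeasure (density lborel (\<lambda>x. ennreal (max 0 (- G x)))) {a<..}"
      by (simp add: emeasure_density eq)
    have "emeasure (density lborel (\<lambda>x. ennreal (max 0 (G x)))) {a<..} \<le> (\<integral>\<^sup>+x. ennreal (max 0 (G x)) \<partial>lborel)"
      by (auto simp: emeasure_density intro!: nn_integral_mono split: split_indicator)
    then show "emeasure (density lborel (\<lambda>x. ennreal (max 0 (G x)))) {a<..} < \<infinity>"
      using fin by (metis infinity_ennreal_def le_less_trans less_top)
  qed auto
  then have "AE x in lborel. ennreal (max 0 (G x)) = ennreal (max 0 (- G x))"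
    using fin by (subst (asm) finite_density_unique) auto
  then show ?thesis
    unfolding AE_lebD
    by eventually_elim (auto simp: G_def max_def split: if_splits)
qed

section \<open>Volterra equations\<close>

text \<open>Cramer's rule, with the nonzero determinant extracted from injectivity.\<close>

lemma linear_system_2x2:
  fixes a b c d e f :: real
  assumes inj: "\<And>x y. a * x + b * y = 0 \<Longrightarrow> c * x + d * y = 0 \<Longrightarrow> x = 0 \<and> y = 0"
  obtains x y where "a * x + b * y = e" "c * x + d * y = f"
proof -
  define D where "D = a * d - b * c"
  have "D \<noteq> 0"
  proof
    assume D: "D = 0"
    \<comment> \<open>If the determinant vanishes, both columns of the adjugate matrix,
      \<open>(d, - c)\<close> and \<open>(- b, a)\<close>, lie in the kernel; so the matrix is zero,
      and then \<open>(1, 1)\<close> is in the kernel too.\<close>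
    have "d = 0 \<and> - c = 0"
      using D by (intro inj) (auto simp: D_def algebra_simps)
    moreover have "- b = 0 \<and> a = 0"
      using D by (intro inj) (auto simp: D_def algebra_simps)
    ultimately show False using inj[of 1 1] by simp
  qed
  have "a * ((d * e - b * f) / D) + b * ((a * f - c * e) / D) = e * D / D"
    by (simp add: D_def add_divide_distrib[symmetric] algebra_simps)
  moreover have "c * ((d * e - b * f) / D) + d * ((a * f - c * e) / D) = f * D / D"
    by (simp add: D_def add_divide_distrib[symmetric] algebra_simps)
  ultimately show ?thesis
    by (intro that) (simp_all only: nonzero_mult_div_cancel_right[OF \<open>D \<noteq> 0\<close>])
qed

text \<open>These are the properties of the fractional kernel that the argument rests on. The bound
  on the rows holds at every \<open>x\<close> of the closed interval, which gives a meaning to the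
  point value \<open>K g 1\<close>; \<open>k_zero\<close> says that \<open>K g x\<close> depends
  only on the values of \<open>g\<close> before \<open>x\<close>.\<close>

locale volterra =
  fixes k :: "real \<Rightarrow> real \<Rightarrow> real" and q :: "real \<Rightarrow> real" and M Q :: real
  assumes k_measurable: "(\<lambda>(x, t). k x t) \<in> borel_measurable (borel \<Otimes>\<^sub>M borel)"
    and k_zero: "x \<le> t \<Longrightarrow> k x t = 0"
    and k_L2: "x \<in> {0..1} \<Longrightarrow> sq_integrable lebD (k x)"
    and k_bound: "x \<in> {0..1} \<Longrightarrow> (\<integral>t. (k x t)\<^sup>2 \<partial>lebD) \<le> M"
    and q_measurable [measurable]: "q \<in> borel_measurable lebD"
    and q_bound: "AE x in lebD. \<bar>q x\<bar> \<le> Q"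
begin

section \<open>The integral operator \<open>K\<close>, the Volterra operator \<open>S\<close> and
  their equations\<close>

definition K :: "(real \<Rightarrow> real) \<Rightarrow> real \<Rightarrow> real" where
  "K g x = (\<integral>t. k x t * g t \<partial>lebD)"

definition S :: "(real \<Rightarrow> real) \<Rightarrow> real \<Rightarrow> real" where
  "S g = prim (\<lambda>x. q x * K g x)"

lemma M_nonneg: "0 \<le> M"
  using k_bound[of 0] by (meson Bochner_Integration.integral_nonneg atLeastAtMost_iff order.trans
      order.refl zero_le_one zero_le_power2)

lemma Q_nonneg: "0 \<le> Q"
proof -
  have "AE x in lebD. 0 \<le> Q" using q_bound by eventually_elim auto
  then show ?thesis by simp
qed

lemma k_measurable_lebD [measurable]: "(\<lambda>(x, t). k x t) \<in> borel_measurable (lebD \<Otimes>\<^sub>M lebD)"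
proof -
  have "(\<lambda>z. (fst z, snd z)) \<in> measurable (lebD \<Otimes>\<^sub>M lebD) (borel \<Otimes>\<^sub>M borel :: (real \<times> real) measure)"
    by (intro measurable_Pair measurable_compose[OF measurable_fst ident_measurable_lebD]
        measurable_compose[OF measurable_snd ident_measurable_lebD])
  from measurable_compose[OF this k_measurable] show ?thesis
    by (simp add: case_prod_beta)
qed

lemma K_measurable [measurable]:
  assumes [measurable]: "g \<in> borel_measurable lebD"
  shows "K g \<in> borel_measurable lebD"
  unfolding K_def by (rule lebD.borel_measurable_lebesgue_integral) measurable

lemma abs_K_le:
  assumes g: "sq_integrable lebD g" and x: "x \<in> {0..1}"
  shows "\<bar>K g x\<bar> \<le> sqrt M * sqrt (\<integral>t. (g t)\<^sup>2 \<partial>lebD)"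
proof -
  have "\<bar>K g x\<bar> \<le> sqrt (\<integral>t. (k x t)\<^sup>2 \<partial>lebD) * sqrt (\<integral>t. (g t)\<^sup>2 \<partial>lebD)"
    unfolding K_def by (rule Cauchy_Schwarz_integral[OF k_L2[OF x] g])
  also have "\<dots> \<le> sqrt M * sqrt (\<integral>t. (g t)\<^sup>2 \<partial>lebD)"
    using k_bound[OF x] by (intro mult_right_mono) auto
  finally show ?thesis .
qed

lemma K_lincomb:
  assumes "sq_integrable lebD f" "sq_integrable lebD g" "x \<in> {0..1}"
  shows "K (\<lambda>t. a * f t + b * g t) x = a * K f x + b * K g x"
proof -
  have "K (\<lambda>t. a * f t + b * g t) x = (\<integral>t. a * (k x t * f t) + b * (k x t * g t) \<partial>lebD)"
    unfolding K_def by (intro Bochner_Integration.integral_cong) (auto simp: algebra_simps)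
  then show ?thesis
    using sq_integrable_mult[OF k_L2 assms(1)] sq_integrable_mult[OF k_L2 assms(2)] assms(3)
    by (simp add: K_def)
qed

text \<open>The conclusion holds at every point, including \<open>x = 1\<close>. Weak derivatives
  are fixed only almost everywhere, so the point value in the form must be independent of the
  representative.\<close>

lemma K_cong_AE:
  assumes "AE x in lebD. f x = g x" "f \<in> borel_measurable lebD" "g \<in> borel_measurable lebD"
    "x \<in> {0..1}"
  shows "K f x = K g x"
proof -
  have [measurable]: "k x \<in> borel_measurable lebD" using k_L2[OF assms(4)] by auto
  show ?thesis
    unfolding K_def using assms by (intro integral_cong_AE) auto
qed

lemma q_K_bound:
  assumes "sq_integrable lebD g"
  shows "AE x in lebD. \<bar>q x * K g x\<bar> \<le> Q * (sqrt M * sqrt (\<integral>t. (g t)\<^sup>2 \<partial>lebD))"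
  using q_bound AE_space
proof eventually_elim
  case (elim x)
  then show ?case
    using abs_K_le[OF assms, of x] Q_nonneg by (auto simp: abs_mult intro!: mult_mono)
qed

lemma sq_integrable_q_K:
  assumes "sq_integrable lebD g"
  shows "sq_integrable lebD (\<lambda>x. q x * K g x)"
  using assms q_K_bound[OF assms]
  by (intro sq_integrable_bounded[OF lebD.finite_measure_axioms]) auto

lemmas integrable_q_K = sq_integrable_integrable[OF lebD.finite_measure_axioms sq_integrable_q_K]

lemma sq_integrable_S: "sq_integrable lebD g \<Longrightarrow> sq_integrable lebD (S g)"
  unfolding S_def by (intro sq_integrable_prim integrable_q_K)

lemma S_lincomb:
  assumes "sq_integrable lebD f" "sq_integrable lebD g"
  shows "S (\<lambda>t. a * f t + b * g t) t = a * S f t + b * S g t"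
proof -
  have "S (\<lambda>t. a * f t + b * g t) t = prim (\<lambda>x. a * (q x * K f x) + b * (q x * K g x)) t"
    unfolding S_def prim_def
    by (intro Bochner_Integration.integral_cong) (auto simp: K_lincomb[OF assms] algebra_simps)
  then show ?thesis
    using assms by (simp add: prim_lincomb integrable_q_K S_def)
qed

lemma S_cong_AE:
  assumes "AE x in lebD. f x = g x" "f \<in> borel_measurable lebD" "g \<in> borel_measurable lebD"
  shows "S f t = S g t"
  unfolding S_def prim_def
  by (intro Bochner_Integration.integral_cong) (auto simp: K_cong_AE[OF assms])

text \<open>Where the kernel does not vanish, \<open>t < x\<close>, and the weight
  \<open>exp (l * t)\<close> is at most \<open>exp (l * x)\<close>. The remaining integral of
  \<open>\<bar>k x t\<bar>\<close> is controlled through \<open>\<bar>k\<bar> \<le> 1 + k^2\<close>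
  by \<open>1 + M\<close>.\<close>

lemma abs_K_le_exp:
  assumes g: "sq_integrable lebD g" and bd: "\<And>t. t \<in> {0<..<1} \<Longrightarrow> \<bar>g t\<bar> \<le> B * exp (l * t)"
    and l: "0 \<le> l" and x: "x \<in> {0..1}"
  shows "\<bar>K g x\<bar> \<le> (1 + M) * (B * exp (l * x))"
proof -
  have B: "0 \<le> B"
    \<comment> \<open>Any sample point of the open interval shows that \<open>B\<close> is
      nonnegative.\<close>
    using order.trans[OF abs_ge_zero bd[of "1/2"]] by (simp add: zero_le_mult_iff)
  have "\<bar>K g x\<bar> \<le> (\<integral>t. \<bar>k x t * g t\<bar> \<partial>lebD)"
    unfolding K_def by (rule integral_abs_bound)
  also have "\<dots> \<le> (\<integral>t. (1 + (k x t)\<^sup>2) * (B * exp (l * x)) \<partial>lebD)"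
  proof (rule integral_mono)
    show "integrable lebD (\<lambda>t. \<bar>k x t * g t\<bar>)"
      using sq_integrable_mult[OF k_L2[OF x] g] by auto
    show "integrable lebD (\<lambda>t. (1 + (k x t)\<^sup>2) * (B * exp (l * x)))"
      using k_L2[OF x] by (auto simp: sq_integrable_def)
    fix t assume t: "t \<in> space lebD"
    show "\<bar>k x t * g t\<bar> \<le> (1 + (k x t)\<^sup>2) * (B * exp (l * x))"
    proof (cases "x \<le> t")
      case True
      then show ?thesis using k_zero B by (simp add: zero_le_mult_iff)
    next
      case False
      have "\<bar>k x t\<bar> \<le> 1 + (k x t)\<^sup>2"
        using sum_squares_bound[of 1 "\<bar>k x t\<bar>"] by simp
      moreover have "\<bar>g t\<bar> \<le> B * exp (l * x)"
        using bd[of t] t False l B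
        by (smt (verit) exp_le_cancel_iff mult_left_mono space_lebD)
      ultimately show ?thesis by (simp add: abs_mult mult_mono)
    qed
  qed
  also have "\<dots> = (1 + (\<integral>t. (k x t)\<^sup>2 \<partial>lebD)) * (B * exp (l * x))"
    using k_L2[OF x] by (simp add: sq_integrable_def lebD.prob_space[simplified])
  also have "\<dots> \<le> (1 + M) * (B * exp (l * x))"
    using k_bound[OF x] B by (intro mult_right_mono) auto
  finally show ?thesis .
qed

text \<open>In the sup norm weighted by \<open>exp (- (l * t))\<close> the norm of \<open>S\<close>
  is at most \<open>Q * (1 + M) / l\<close>: the pointwise bound on \<open>K g\<close> is integrated
  against the weight.\<close>

lemma abs_S_le_exp:
  assumes g: "sq_integrable lebD g" and bd: "\<And>t. t \<in> {0<..<1} \<Longrightarrow> \<bar>g t\<bar> \<le> B * exp (l * t)"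
    and l: "0 < l" and t: "t \<in> {0..1}"
  shows "\<bar>S g t\<bar> \<le> Q * (1 + M) / l * (B * exp (l * t))"
proof -
  let ?C = "Q * (1 + M) * B"
  have B: "0 \<le> B"
    using order.trans[OF abs_ge_zero bd[of "1/2"]] by (simp add: zero_le_mult_iff)
  have int_exp: "integrable lebD (\<lambda>s. exp (l * s))"
    by (rule lebD.integrable_const_bound[of _ "exp l"]) (use l in auto)
  have "\<bar>S g t\<bar> \<le> (\<integral>s. \<bar>indicator {..<t} s * (q s * K g s)\<bar> \<partial>lebD)"
    unfolding S_def prim_def by (rule integral_abs_bound)
  also have "\<dots> \<le> (\<integral>s. ?C * (indicator {..<t} s * exp (l * s)) \<partial>lebD)"
  proof (rule integral_mono_AE)
    show "integrable lebD (\<lambda>s. \<bar>indicator {..<t} s * (q s * K g s)\<bar>)"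
      by (intro integrable_abs integrable_indicator_lebD integrable_q_K g)
    show "integrable lebD (\<lambda>s. ?C * (indicator {..<t} s * exp (l * s)))"
      by (intro integrable_mult_right integrable_indicator_lebD int_exp)
    show "AE s in lebD. \<bar>indicator {..<t} s * (q s * K g s)\<bar> \<le> ?C * (indicator {..<t} s * exp (l * s))"
      using q_bound AE_space
    proof eventually_elim
      case (elim s)
      have "\<bar>K g s\<bar> \<le> (1 + M) * (B * exp (l * s))"
        using elim l by (intro abs_K_le_exp[OF g bd]) auto
      then have "\<bar>q s\<bar> * \<bar>K g s\<bar> \<le> Q * ((1 + M) * (B * exp (l * s)))"
        using elim Q_nonneg by (intro mult_mono) auto
      then show ?case by (auto simp: abs_mult mult_ac split: split_indicator)
    qed
  qed
  also have "\<dots> = ?C * prim (\<lambda>s. exp (l * s)) t"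
    by (simp add: prim_def)
  also have "\<dots> \<le> ?C * (exp (l * t) / l)"
    using B Q_nonneg M_nonneg by (intro mult_left_mono prim_exp_le l t) auto
  finally show ?thesis by (simp add: mult_ac)
qed

text \<open>Banach's fixed point theorem for bounded continuous functions. Since \<open>f\<close>
  may be discontinuous, the unknown is not \<open>g\<close> but the weighted correction
  \<open>z t = exp (- (l * t)) * (g t - f t)\<close>, which equals the weighted \<open>S g t\<close>
  and is therefore continuous.\<close>

lemma S_equation_solvable:
  assumes f: "sq_integrable lebD f"
  obtains g where "sq_integrable lebD g" "\<And>t. t \<in> {0..1} \<Longrightarrow> g t - S g t = f t"
proof -
  \<comment> \<open>The factor 2 yields contraction constant 1/2; the added 1 keeps \<open>l\<close>
    positive when \<open>Q = 0\<close>.\<close>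
  define l where "l = 2 * (Q * (1 + M)) + 1"
  have l: "0 < l" "Q * (1 + M) / l \<le> 1 / 2"
  proof -
    have "0 \<le> Q * (1 + M)" using Q_nonneg M_nonneg by simp
    then show "0 < l" unfolding l_def by linarith
    then show "Q * (1 + M) / l \<le> 1 / 2"
      by (simp only: pos_divide_le_eq) (simp add: l_def)
  qed
  \<comment> \<open>The type of bounded continuous functions used here has the whole line as its
    domain, so everything is composed with the clamp onto the unit interval.\<close>
  define cl :: "real \<Rightarrow> real" where "cl t = max 0 (min 1 t)" for t
  have cl: "cl t \<in> {0..1}" for t by (auto simp: cl_def)
  have cl_id: "cl t = t" if "t \<in> {0..1}" for t using that by (auto simp: cl_def)
  have cl_cont: "continuous_on UNIV cl" unfolding cl_def by (intro continuous_intros)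
  define G where "G z = (\<lambda>s. f s + apply_bcontfun z s * exp (l * cl s))" for z
  define H where "H z t = exp (- (l * cl t)) * S (G z) (cl t)" for z t
  have weighted: "sq_integrable lebD (\<lambda>s. apply_bcontfun z s * exp (l * cl s))" for z
  proof (rule sq_integrable_bounded[OF lebD.finite_measure_axioms])
    have "continuous_on UNIV (apply_bcontfun z)" by simp
    then have [measurable]: "apply_bcontfun z \<in> borel_measurable borel"
      by (rule borel_measurable_continuous_onI)
    have [measurable]: "cl \<in> borel_measurable borel"
      by (rule borel_measurable_continuous_onI[OF cl_cont])
    show "(\<lambda>s. apply_bcontfun z s * exp (l * cl s)) \<in> borel_measurable lebD"
      by (intro borel_measurable_lebD_I) measurable
    show "AE s in lebD. \<bar>apply_bcontfun z s * exp (l * cl s)\<bar> \<le> norm z * exp (l * 1)"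
      using norm_bounded[of z] cl l by (intro AE_I2) (auto simp: abs_mult intro!: mult_mono)
  qed
  have G: "sq_integrable lebD (G z)" for z
    unfolding G_def by (intro sq_integrable_add f weighted)
  have H: "H z \<in> bcontfun" for z
  proof (rule bcontfun_normI)
    have "continuous_on {0..1} (S (G z))"
      unfolding S_def using sq_integrable_q_K[OF G] q_K_bound[OF G]
      by (intro continuous_on_prim) auto
    then have "continuous_on UNIV (\<lambda>t. S (G z) (cl t))"
      using cl by (intro continuous_on_compose2[OF _ cl_cont]) auto
    then show "continuous_on UNIV (H z)"
      unfolding H_def by (intro continuous_intros cl_cont)
    have "\<bar>S (G z) s\<bar> \<le> (\<integral>x. \<bar>q x * K (G z) x\<bar> \<partial>lebD)" for s
      unfolding S_def by (intro abs_prim_le integrable_q_K G)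
    then show "norm (H z t) \<le> 1 * (\<integral>x. \<bar>q x * K (G z) x\<bar> \<partial>lebD)" for t
      unfolding H_def real_norm_def abs_mult using cl[of t] l
      by (intro mult_mono) auto
  qed
  have "\<exists>!z. z \<in> UNIV \<and> Bcontfun (H z) = z"
  proof (rule Banach_fix[of UNIV "1/2"])
    fix z1 z2 :: "real \<Rightarrow>\<^sub>C real"
    show "dist (Bcontfun (H z1)) (Bcontfun (H z2)) \<le> 1 / 2 * dist z1 z2"
    proof (rule dist_bound)
      fix t
      \<comment> \<open>The inhomogeneity \<open>f\<close> cancels in the difference, which leaves
        \<open>z1 - z2\<close> times the weight. The coefficients 1 and -1 are written out to fit
        \<open>S_lincomb\<close>.\<close>
      let ?D = "\<lambda>s. 1 * G z1 s + (- 1) * G z2 s"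
      have "\<bar>S ?D (cl t)\<bar> \<le> Q * (1 + M) / l * (dist z1 z2 * exp (l * cl t))"
      proof (rule abs_S_le_exp[OF sq_integrable_lincomb[OF G G] _ l(1) cl])
        fix s :: real assume "s \<in> {0<..<1}"
        then have "?D s = (apply_bcontfun z1 s - apply_bcontfun z2 s) * exp (l * s)"
          by (simp add: G_def cl_id algebra_simps)
        then show "\<bar>?D s\<bar> \<le> dist z1 z2 * exp (l * s)"
          using dist_bounded[of z1 s z2] by (simp add: abs_mult dist_real_def)
      qed
      also have "\<dots> \<le> 1 / 2 * (dist z1 z2 * exp (l * cl t))"
        by (intro mult_right_mono l) auto
      finally have "exp (- (l * cl t)) * \<bar>S ?D (cl t)\<bar> \<le>
          exp (- (l * cl t)) * (1 / 2 * (dist z1 z2 * exp (l * cl t)))"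
        by (rule mult_left_mono) simp
      also have "\<dots> = 1 / 2 * dist z1 z2"
        by (simp add: exp_minus field_simps)
      finally have "\<bar>exp (- (l * cl t)) * S ?D (cl t)\<bar> \<le> 1 / 2 * dist z1 z2"
        by (simp add: abs_mult)
      moreover have "exp (- (l * cl t)) * S ?D (cl t) = H z1 t - H z2 t"
        unfolding S_lincomb[OF G G] H_def by (simp add: algebra_simps)
      ultimately show "dist (apply_bcontfun (Bcontfun (H z1)) t) (apply_bcontfun (Bcontfun (H z2)) t)
          \<le> 1 / 2 * dist z1 z2"
        by (simp add: Bcontfun_inverse[OF H] dist_real_def)
    qed
  qed (auto simp: complete_UNIV)
  then obtain z where z: "Bcontfun (H z) = z" by auto
  have "G z t - S (G z) t = f t" if "t \<in> {0..1}" for t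
  proof -
    have "apply_bcontfun z t = H z t" using Bcontfun_inverse[OF H, of z] z by simp
    then show ?thesis using that by (simp add: G_def[of z] H_def cl_id exp_minus)
  qed
  with G show ?thesis using that by blast
qed

lemma perturbed_equation_solvable:
  assumes P: "sq_integrable lebD P"
    and inj: "\<And>g c. sq_integrable lebD g \<Longrightarrow> (\<integral>t. g t \<partial>lebD) = 0 \<Longrightarrow>
      (\<And>t. t \<in> {0..1} \<Longrightarrow> g t - S g t - K g 1 * P t = c) \<Longrightarrow> AE t in lebD. g t = 0"
    and f: "sq_integrable lebD f"
  obtains g c where "sq_integrable lebD g" "(\<integral>t. g t \<partial>lebD) = 0"
    "\<And>t. t \<in> {0..1} \<Longrightarrow> g t - S g t - K g 1 * P t = f t + c"
proof -
  have I: "integrable lebD h" if "sq_integrable lebD h" for h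
    using that by (rule sq_integrable_integrable[OF lebD.finite_measure_axioms])
  obtain g0 where g0: "sq_integrable lebD g0" "\<And>t. t \<in> {0..1} \<Longrightarrow> g0 t - S g0 t = f t"
    using S_equation_solvable[OF f] by blast
  obtain g1 where g1: "sq_integrable lebD g1" "\<And>t. t \<in> {0..1} \<Longrightarrow> g1 t - S g1 t = 1"
    using S_equation_solvable[OF sq_integrable_const[OF lebD.finite_measure_axioms]] by blast
  obtain g2 where g2: "sq_integrable lebD g2" "\<And>t. t \<in> {0..1} \<Longrightarrow> g2 t - S g2 t = P t"
    using S_equation_solvable[OF P] by blast
  \<comment> \<open>The coefficient \<open>e\<close> is 1 for the equation to be solved and 0 for
    the homogeneous problem that shows the system to be nonsingular.\<close>
  define g where "g e c d t = e * g0 t + 1 * (c * g1 t + d * g2 t)" for e c d t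
  have g12: "sq_integrable lebD (\<lambda>t. c * g1 t + d * g2 t)" for c d
    by (intro sq_integrable_lincomb g1 g2)
  have g: "sq_integrable lebD (g e c d)" for e c d
    unfolding g_def[abs_def] by (intro sq_integrable_lincomb[OF g0(1) g12])
  have int_g: "(\<integral>t. g e c d t \<partial>lebD) = e * (\<integral>t. g0 t \<partial>lebD) + ((\<integral>t. g1 t \<partial>lebD) * c + (\<integral>t. g2 t \<partial>lebD) * d)"
    for e c d
    unfolding g_def using I[OF g0(1)] I[OF g1(1)] I[OF g2(1)] by simp
  have K_g: "K (g e c d) 1 = e * K g0 1 + (K g1 1 * c + K g2 1 * d)" for e c d
    unfolding g_def[abs_def]
      using K_lincomb[OF g0(1) g12, of 1 e 1 c d] K_lincomb[OF g1(1) g2(1), of 1 c d]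
      by (simp add: mult.commute)
  have S_g: "g e c d t - S (g e c d) t = e * f t + c + d * P t" if "t \<in> {0..1}" for e c d t
  proof -
    have "S (g e c d) t = e * S g0 t + 1 * (c * S g1 t + d * S g2 t)"
      unfolding g_def[abs_def] by (simp only: S_lincomb[OF g0(1) g12] S_lincomb[OF g1(1) g2(1)])
    then have "g e c d t - S (g e c d) t =
        e * (g0 t - S g0 t) + c * (g1 t - S g1 t) + d * (g2 t - S g2 t)"
      by (simp add: g_def algebra_simps)
    then show ?thesis using g0(2) g1(2) g2(2) that by simp
  qed
  \<comment> \<open>The first equation is the mean-zero condition. The second is the consistency
    condition \<open>K (g 1 c d) 1 = d\<close>, with \<open>d\<close> moved to the left.\<close>
  obtain c d where
    1: "(\<integral>t. g1 t \<partial>lebD) * c + (\<integral>t. g2 t \<partial>lebD) * d = - (\<integral>t. g0 t \<partial>lebD)" and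
    2: "K g1 1 * c + (K g2 1 - 1) * d = - K g0 1"
  proof (rule linear_system_2x2[of "\<integral>t. g1 t \<partial>lebD" "\<integral>t. g2 t \<partial>lebD" "K g1 1" "K g2 1 - 1"])
    fix c d
    assume c: "(\<integral>t. g1 t \<partial>lebD) * c + (\<integral>t. g2 t \<partial>lebD) * d = 0"
      and d: "K g1 1 * c + (K g2 1 - 1) * d = 0"
    let ?g = "g 0 c d"
    have K: "K ?g 1 = d" using d by (simp add: K_g algebra_simps)
    \<comment> \<open>A solution of the homogeneous system satisfies the homogeneous perturbed
      equation, so it vanishes almost everywhere. Then \<open>d = K ?g 1 = 0\<close>, and the
      equation itself leaves \<open>c = 0\<close>.\<close>
    have ae: "AE t in lebD. ?g t = 0"
      using c S_g[of _ 0 c d] by (intro inj[of _ c] g) (auto simp: int_g K)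
    have meas: "?g \<in> borel_measurable lebD" using g by auto
    have "K ?g 1 = K (\<lambda>t. 0) 1"
      by (rule K_cong_AE[OF ae meas]) auto
    then have "d = 0" using K by (simp add: K_def)
    have "S ?g t = S (\<lambda>t. 0) t" for t
      by (rule S_cong_AE[OF ae meas]) auto
    then have S0: "S ?g t = 0" for t by (simp add: S_def K_def prim_def)
    have "AE t in lebD. c = 0"
      using ae AE_space
    proof eventually_elim
      case (elim t)
      then show ?case using S_g[of t 0 c d] S0 \<open>d = 0\<close> by simp
    qed
    then show "c = 0 \<and> d = 0" using \<open>d = 0\<close> by simp
  qed blast
  show ?thesis
  proof (rule that[of "g 1 c d" c])
    have "K (g 1 c d) 1 = d" using 2 by (simp add: K_g algebra_simps)
    then show "g 1 c d t - S (g 1 c d) t - K (g 1 c d) 1 * P t = f t + c" if "t \<in> {0..1}" for t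
      using S_g[OF that, of 1 c d] by simp
  qed (use g 1 in \<open>auto simp: int_g\<close>)
qed

text \<open>Two integrations by parts move the primitive from \<open>\<psi>\<close> onto
  \<open>q * K g\<close> and onto \<open>p\<close>. The boundary terms carry the factor
  \<open>\<integral> \<psi> = 0\<close>, and each remaining term changes sign.\<close>

lemma weak_form_eq:
  assumes g: "sq_integrable lebD g" and p: "sq_integrable lebD p"
    and \<psi>: "sq_integrable lebD \<psi>" "(\<integral>x. \<psi> x \<partial>lebD) = 0"
  shows "(\<integral>x. g x * \<psi> x \<partial>lebD) + ((\<integral>x. K g x * (q x * prim \<psi> x) \<partial>lebD) + K g 1 * (\<integral>x. p x * prim \<psi> x \<partial>lebD))
    = (\<integral>x. (g x - S g x - K g 1 * prim p x) * \<psi> x \<partial>lebD)"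
proof -
  have I: "integrable lebD h" if "sq_integrable lebD h" for h
    using that by (rule sq_integrable_integrable[OF lebD.finite_measure_axioms])
  have "(\<integral>x. K g x * (q x * prim \<psi> x) \<partial>lebD) = - (\<integral>x. \<psi> x * S g x \<partial>lebD)"
    using integral_prim_by_parts[OF integrable_q_K[OF g] I[OF \<psi>(1)]] \<psi>(2)
    by (simp add: S_def mult_ac)
  moreover have "(\<integral>x. p x * prim \<psi> x \<partial>lebD) = - (\<integral>x. \<psi> x * prim p x \<partial>lebD)"
    using integral_prim_by_parts[OF I[OF p] I[OF \<psi>(1)]] \<psi>(2) by simp
  moreover have "(\<integral>x. (g x - S g x - K g 1 * prim p x) * \<psi> x \<partial>lebD) =
      (\<integral>x. g x * \<psi> x \<partial>lebD) - (\<integral>x. \<psi> x * S g x \<partial>lebD) - K g 1 * (\<integral>x. \<psi> x * prim p x \<partial>lebD)"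
  proof -
    have "(\<integral>x. (g x - S g x - K g 1 * prim p x) * \<psi> x \<partial>lebD) =
      (\<integral>x. g x * \<psi> x - \<psi> x * S g x - K g 1 * (\<psi> x * prim p x) \<partial>lebD)"
      by (intro Bochner_Integration.integral_cong) (auto simp: algebra_simps)
    then show ?thesis
      using sq_integrable_mult[OF g \<psi>(1)] sq_integrable_mult[OF \<psi>(1) sq_integrable_S[OF g]]
        sq_integrable_mult[OF \<psi>(1) sq_integrable_prim[OF I[OF p]]]
      by simp
  qed
  ultimately show ?thesis by simp
qed

end

section \<open>The variational problem\<close>

definition is_wderiv :: "(real \<Rightarrow> real) \<Rightarrow> (real \<Rightarrow> real) \<Rightarrow> bool" where
  "is_wderiv w g \<longleftrightarrow> sq_integrable lebD g \<and> (\<integral>x. g x \<partial>lebD) = 0 \<and>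
    (\<forall>x. w x = (if x \<in> {0..1} then prim g x else 0))"

lemma is_wderivD:
  assumes "is_wderiv w g"
  shows "sq_integrable lebD g" "integrable lebD g" "(\<integral>x. g x \<partial>lebD) = 0"
    "x \<in> {0..1} \<Longrightarrow> w x = prim g x"
  using assms sq_integrable_integrable[OF lebD.finite_measure_axioms] by (auto simp: is_wderiv_def)

lemma is_wderiv_iff:
  "is_wderiv w g \<longleftrightarrow> L2D g \<and> (LINT t:{0<..<1}|lborel. g t) = 0
    \<and> (\<forall>x. w x = (if x \<in> {0..1} then (LINT t:{0<..<x}|lborel. g t) else 0))"
  unfolding is_wderiv_def L2D_iff integral_lebD[symmetric]
  by (simp add: set_integral_lebD prim_def cong: if_cong)

lemma H10_iff: "w \<in> H10 \<longleftrightarrow> (\<exists>g. is_wderiv w g)"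
  by (simp add: H10_def is_wderiv_iff)

lemma is_wderiv_imp_H10: "is_wderiv w g \<Longrightarrow> w \<in> H10"
  by (auto simp: H10_iff)

lemma is_wderiv_wderiv: "w \<in> H10 \<Longrightarrow> is_wderiv w (wderiv w)"
  unfolding wderiv_def is_wderiv_iff[symmetric] H10_iff using someI_ex[of "is_wderiv w"] by simp

lemma is_wderiv_lincomb:
  assumes "is_wderiv u f" "is_wderiv v g"
  shows "is_wderiv (\<lambda>x. a * u x + b * v x) (\<lambda>x. a * f x + b * g x)"
  using assms
  by (auto simp: is_wderiv_def sq_integrable_lincomb prim_lincomb
      sq_integrable_integrable[OF lebD.finite_measure_axioms])

lemma is_wderiv_primitive:
  assumes "sq_integrable lebD g" "(\<integral>x. g x \<partial>lebD) = 0"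
  shows "is_wderiv (\<lambda>x. if x \<in> {0..1} then prim g x else 0) g"
  using assms by (simp add: is_wderiv_def)

lemma is_wderiv_unique:
  assumes "is_wderiv w f" "is_wderiv w g"
  shows "AE x in lebD. f x = g x"
proof -
  have "AE x in lebD. 1 * f x + (-1) * g x = 0"
  proof (rule prim_eq_0_imp_AE)
    show "integrable lebD (\<lambda>x. 1 * f x + (-1) * g x)"
      using is_wderivD(2)[OF assms(1)] is_wderivD(2)[OF assms(2)] by simp
    fix x :: real assume "x \<in> {0..1}"
    then show "prim (\<lambda>x. 1 * f x + (-1) * g x) x = 0"
      using is_wderivD(4)[OF assms(1)] is_wderivD(4)[OF assms(2)]
      by (simp only: prim_lincomb[OF is_wderivD(2)[OF assms(1)] is_wderivD(2)[OF assms(2)]])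
  qed
  then show ?thesis by eventually_elim simp
qed

text \<open>Frees the norm from the particular derivative selected by \<open>wderiv\<close>.\<close>

lemma normV_eq:
  assumes "is_wderiv w g"
  shows "normV w = sqrt (\<integral>x. (g x)\<^sup>2 \<partial>lebD)"
proof -
  have w: "is_wderiv w (wderiv w)" using is_wderiv_wderiv[OF is_wderiv_imp_H10[OF assms]] .
  have [measurable]: "g \<in> borel_measurable lebD" "wderiv w \<in> borel_measurable lebD"
    using is_wderivD(1)[OF assms] is_wderivD(1)[OF w] by auto
  have "(\<integral>x. wderiv w x * wderiv w x \<partial>lebD) = (\<integral>x. (g x)\<^sup>2 \<partial>lebD)"
  proof (rule integral_cong_AE)
    show "AE x in lebD. wderiv w x * wderiv w x = (g x)\<^sup>2"
      using is_wderiv_unique[OF assms w] by eventually_elim (simp add: power2_eq_square)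
  qed measurable
  then show ?thesis by (simp add: normV_def ipD_eq)
qed

text \<open>\<open>F\<close> is transported to all square-integrable \<open>u\<close>: subtracting
  the mean and taking the primitive gives \<open>W u\<close> in V, and
  \<open>u \<mapsto> F (W u)\<close> is linear and bounded there. A derivative already has mean
  zero, so \<open>W \<psi> = \<phi>\<close> recovers \<open>F\<close>.\<close>

lemma dualV_Riesz:
  assumes "dualV F"
  obtains f where "sq_integrable lebD f"
    "\<And>\<phi> \<psi>. is_wderiv \<phi> \<psi> \<Longrightarrow> F \<phi> = (\<integral>x. f x * \<psi> x \<partial>lebD)"
proof -
  define E where "E u = (\<integral>x. u x \<partial>lebD)" for u :: "real \<Rightarrow> real"
  define c where "c u = (\<lambda>x. 1 * u x + (- E u) * 1)" for u :: "real \<Rightarrow> real"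
  define W where "W u = (\<lambda>x. if x \<in> {0..1} then prim (c u) x else 0)" for u
  have one: "sq_integrable lebD (\<lambda>x. 1)"
    by (rule sq_integrable_const[OF lebD.finite_measure_axioms])
  have I: "integrable lebD u" if "sq_integrable lebD u" for u
    using that by (rule sq_integrable_integrable[OF lebD.finite_measure_axioms])
  have c: "sq_integrable lebD (c u)" "(\<integral>x. c u x \<partial>lebD) = 0" if "sq_integrable lebD u" for u
  proof -
    show "sq_integrable lebD (c u)" unfolding c_def by (intro sq_integrable_lincomb that one)
    show "(\<integral>x. c u x \<partial>lebD) = 0"
      using I[OF that] by (simp add: c_def E_def lebD.prob_space[simplified])
  qed
  have W: "is_wderiv (W u) (c u)" if "sq_integrable lebD u" for u
    unfolding W_def by (rule is_wderiv_primitive[OF c[OF that]])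
  have F: "F (\<lambda>x. a * u x + b * v x) = a * F u + b * F v" if "u \<in> H10" "v \<in> H10" for a b u v
    using assms that by (simp add: dualV_def)
  obtain C where C: "\<And>v. v \<in> H10 \<Longrightarrow> \<bar>F v\<bar> \<le> C * normV v"
    using assms unfolding dualV_def by blast
  obtain f where f: "sq_integrable lebD f"
    and Ff: "\<And>u. sq_integrable lebD u \<Longrightarrow> F (W u) = (\<integral>x. f x * u x \<partial>lebD)"
  proof (rule L2_Riesz[OF prob_space_lebD, of "\<lambda>u. F (W u)" "\<bar>C\<bar>"])
    fix u v :: "real \<Rightarrow> real" and a b :: real
    assume u: "sq_integrable lebD u" and v: "sq_integrable lebD v"
    have "E (\<lambda>x. a * u x + b * v x) = a * E u + b * E v"
      using I[OF u] I[OF v] by (simp add: E_def)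
    then have "c (\<lambda>x. a * u x + b * v x) = (\<lambda>x. a * c u x + b * c v x)"
      by (auto simp: c_def algebra_simps)
    then have "W (\<lambda>x. a * u x + b * v x) = (\<lambda>x. a * W u x + b * W v x)"
      using prim_lincomb[OF I[OF c(1)[OF u]] I[OF c(1)[OF v]]] by (auto simp: W_def)
    then show "F (W (\<lambda>x. a * u x + b * v x)) = a * F (W u) + b * F (W v)"
      using F[OF is_wderiv_imp_H10[OF W[OF u]] is_wderiv_imp_H10[OF W[OF v]]] by simp
  next
    fix u assume u: "sq_integrable lebD u"
    \<comment> \<open>The variance identity: removing the mean does not increase the norm.\<close>
    have "(\<integral>x. (c u x)\<^sup>2 \<partial>lebD) = (\<integral>x. (u x)\<^sup>2 \<partial>lebD) - (E u)\<^sup>2"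
      unfolding c_def integral_square_lincomb[OF u one]
      by (simp add: E_def lebD.prob_space[simplified] power2_eq_square)
    then have "normV (W u) \<le> sqrt (\<integral>x. (u x)\<^sup>2 \<partial>lebD)"
      unfolding normV_eq[OF W[OF u]] by (intro real_sqrt_le_mono) simp
    moreover have "0 \<le> normV (W u)" unfolding normV_eq[OF W[OF u]] by simp
    ultimately have "C * normV (W u) \<le> \<bar>C\<bar> * sqrt (\<integral>x. (u x)\<^sup>2 \<partial>lebD)"
      by (intro mult_mono) auto
    moreover have "\<bar>F (W u)\<bar> \<le> C * normV (W u)"
      using W[OF u] by (intro C) (auto simp: H10_iff)
    ultimately show "\<bar>F (W u)\<bar> \<le> \<bar>C\<bar> * sqrt (\<integral>x. (u x)\<^sup>2 \<partial>lebD)" by simp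
  qed blast
  show ?thesis
  proof (rule that[OF f])
    fix \<phi> \<psi> assume w: "is_wderiv \<phi> \<psi>"
    have "c \<psi> = \<psi>" using is_wderivD(3)[OF w] by (simp add: c_def E_def)
    then have "W \<psi> = \<phi>" using w by (auto simp: W_def is_wderiv_def)
    then show "F \<phi> = (\<integral>x. f x * \<psi> x \<partial>lebD)" using Ff[OF is_wderivD(1)[OF w]] by simp
  qed
qed

section \<open>The Riemann-Liouville kernel\<close>

lemma powr_kernel_lebD:
  fixes \<beta> x :: real
  assumes "-1 < \<beta>" "x \<in> {0..1}"
  shows "integrable lebD (\<lambda>t. indicator {..<x} t * (x - t) powr \<beta>)"
    and "(\<integral>t. indicator {..<x} t * (x - t) powr \<beta> \<partial>lebD) \<le> 1 / (\<beta> + 1)"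
proof -
  \<comment> \<open>The integral of the power over \<open>{0..x}\<close> is explicit; the reflection
    of \<open>t\<close> to \<open>x - t\<close> transports it to the kernel.\<close>
  define f where "f u = indicator {0..x} u * u powr \<beta>" for u
  have [measurable]: "f \<in> borel_measurable borel" unfolding f_def[abs_def] by measurable
  have "((\<lambda>u. u powr \<beta>) has_integral (x powr (\<beta> + 1) / (\<beta> + 1))) {0..x}"
    using assms by (intro has_integral_powr_from_0) auto
  then have "(\<integral>\<^sup>+u. ennreal (f u) \<partial>lborel) = ennreal (x powr (\<beta> + 1) / (\<beta> + 1))"
    unfolding f_def by (intro nn_integral_has_integral_lebesgue) auto
  then have f: "has_bochner_integral lborel f (x powr (\<beta> + 1) / (\<beta> + 1))"
    using assms by (intro has_bochner_integral_nn_integral) (auto simp: f_def)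
  define h where "h t = f (x + (-1) * t)" for t
  have h: "integrable lborel h"
    unfolding h_def using f by (intro lborel_integrable_real_affine) (auto simp: has_bochner_integral_iff)
  have h_int: "(\<integral>t. h t \<partial>lborel) = x powr (\<beta> + 1) / (\<beta> + 1)"
    using lborel_integral_real_affine[of "-1" f x] f unfolding h_def
    by (simp add: has_bochner_integral_iff)
  \<comment> \<open>At \<open>t = x\<close> only the right-hand indicator is 1, but the convention
    \<open>0 powr \<beta> = 0\<close> makes both sides vanish.\<close>
  have eq: "indicator {0<..<1} t * (indicator {..<x} t * (x - t) powr \<beta>) = indicator {0<..<1} t * h t" for t
    using assms by (auto simp: h_def f_def split: split_indicator)
  have ih: "integrable lborel (\<lambda>t. indicator {0<..<1} t * h t)"
    using integrable_mult_indicator[OF _ h, of "{0<..<1}"] by simp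
  then show "integrable lebD (\<lambda>t. indicator {..<x} t * (x - t) powr \<beta>)"
    by (simp add: lebD_def integrable_restrict_space eq)
  have "(\<integral>t. indicator {..<x} t * (x - t) powr \<beta> \<partial>lebD) = (\<integral>t. indicator {0<..<1} t * h t \<partial>lborel)"
    by (simp add: integral_lebD set_lebesgue_integral_def eq)
  also have "\<dots> \<le> (\<integral>t. h t \<partial>lborel)"
    by (rule integral_mono[OF ih h]) (simp add: h_def f_def split: split_indicator)
  also have "\<dots> \<le> 1 / (\<beta> + 1)"
    unfolding h_int using assms by (intro divide_right_mono powr_le1) auto
  finally show "(\<integral>t. indicator {..<x} t * (x - t) powr \<beta> \<partial>lebD) \<le> 1 / (\<beta> + 1)" .
qed

definition rl_kernel :: "real \<Rightarrow> real \<Rightarrow> real \<Rightarrow> real" where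
  "rl_kernel \<alpha> x t = indicator {..<x} t * (x - t) powr (\<alpha> - 2) / Gamma (\<alpha> - 1)"

text \<open>The squared kernel has exponent \<open>2 * \<alpha> - 4\<close>, which exceeds -1
  precisely when \<open>3/2 < \<alpha>\<close>; integrating it gives the factor
  \<open>1 / (2 * \<alpha> - 3)\<close>.\<close>

lemma volterra_rl_kernel:
  assumes \<alpha>: "3/2 < \<alpha>" and q: "q \<in> borel_measurable lebD" "AE x in lebD. \<bar>q x\<bar> \<le> Q"
  shows "volterra (rl_kernel \<alpha>) q (1 / (2 * \<alpha> - 3) / (Gamma (\<alpha> - 1))\<^sup>2) Q"
proof
  show "(\<lambda>(x, t). rl_kernel \<alpha> x t) \<in> borel_measurable (borel \<Otimes>\<^sub>M borel)"
  proof -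
    have "(\<lambda>(x, t). rl_kernel \<alpha> x t) =
        (\<lambda>z. if snd z < fst z then (fst z - snd z) powr (\<alpha> - 2) / Gamma (\<alpha> - 1) else 0)"
      by (auto simp: rl_kernel_def)
    then show ?thesis by simp
  qed
  fix x t :: real
  show "x \<le> t \<Longrightarrow> rl_kernel \<alpha> x t = 0" by (simp add: rl_kernel_def)
  assume x: "x \<in> {0..1}"
  have sq: "(rl_kernel \<alpha> x t)\<^sup>2 = indicator {..<x} t * (x - t) powr (2 * \<alpha> - 4) / (Gamma (\<alpha> - 1))\<^sup>2" for t
  proof -
    have "2 * \<alpha> - 4 = (\<alpha> - 2) + (\<alpha> - 2)" by simp
    then have "(x - t) powr (2 * \<alpha> - 4) = ((x - t) powr (\<alpha> - 2))\<^sup>2"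
      by (simp only: powr_add power2_eq_square)
    then show ?thesis
      by (auto simp: rl_kernel_def power_divide power_mult_distrib split: split_indicator)
  qed
  have \<beta>: "-1 < 2 * \<alpha> - 4" using \<alpha> by simp
  have "rl_kernel \<alpha> x \<in> borel_measurable lebD"
    unfolding rl_kernel_def by (intro borel_measurable_lebD_I) measurable
  then show "sq_integrable lebD (rl_kernel \<alpha> x)"
    using powr_kernel_lebD(1)[OF \<beta> x] by (simp add: sq_integrable_def sq)
  show "(\<integral>t. (rl_kernel \<alpha> x t)\<^sup>2 \<partial>lebD) \<le> 1 / (2 * \<alpha> - 3) / (Gamma (\<alpha> - 1))\<^sup>2"
  proof -
    have "1 / (2 * \<alpha> - 4 + 1) = 1 / (2 * \<alpha> - 3)" by simp
    then show ?thesis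
      using divide_right_mono[OF powr_kernel_lebD(2)[OF \<beta> x], of "(Gamma (\<alpha> - 1))\<^sup>2"]
      by (simp only: sq integral_divide_zero zero_le_power2)
  qed
qed (fact q)+

section \<open>Existence and uniqueness of the weak solution\<close>

theorem theorem3p1:
  fixes \<alpha> :: real and q p :: "real \<Rightarrow> real" and F :: "(real \<Rightarrow> real) \<Rightarrow> real"
  assumes "3/2 < \<alpha>" and "\<alpha> < 2"
    and "LinfD q" and "L2D p"
    and "\<And>w. w \<in> H10 \<Longrightarrow> (\<forall>v\<in>H10. form_A \<alpha> q p w v = 0) \<Longrightarrow> w = (\<lambda>x. 0)"
    and "\<And>v. v \<in> H10 \<Longrightarrow> (\<forall>w\<in>H10. form_A \<alpha> q p w v = 0) \<Longrightarrow> v = (\<lambda>x. 0)"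
    and "dualV F"
  shows "\<exists>!w. w \<in> H10 \<and> (\<forall>\<phi>\<in>H10. form_A \<alpha> q p w \<phi> = F \<phi>)"
proof -
  obtain Q where q: "q \<in> borel_measurable lebD" "AE x in lebD. \<bar>q x\<bar> \<le> Q"
    using \<open>LinfD q\<close> by (auto simp: LinfD_iff)
  interpret volterra "rl_kernel \<alpha>" q "1 / (2 * \<alpha> - 3) / (Gamma (\<alpha> - 1))\<^sup>2" Q
    using \<open>3/2 < \<alpha>\<close> q by (rule volterra_rl_kernel)
  have p: "sq_integrable lebD p" using \<open>L2D p\<close> by (simp add: L2D_iff)
  have I: "integrable lebD h" if "sq_integrable lebD h" for h
    using that by (rule sq_integrable_integrable[OF lebD.finite_measure_axioms])
  \<comment> \<open>In terms of \<open>g = w'\<close> the form is the inner product of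
    \<open>R g\<close> with the derivative of the test function.\<close>
  define R where "R g x = g x - S g x - K g 1 * prim p x" for g x
  have sqR: "sq_integrable lebD (R g)" if "sq_integrable lebD g" for g
    unfolding R_def[abs_def]
    by (intro sq_integrable_diff sq_integrable_cmult sq_integrable_prim I p that sq_integrable_S)
  have R_lincomb: "R (\<lambda>x. a * f x + b * g x) x = a * R f x + b * R g x"
    if "sq_integrable lebD f" "sq_integrable lebD g" for a b f g x
    using S_lincomb[OF that] K_lincomb[OF that, of 1] by (simp add: R_def algebra_simps)
  \<comment> \<open>Stated for arbitrary representatives of both derivatives, so that solutions
    constructed from a given \<open>g\<close> can be inserted without reference to the choice made
    by \<open>wderiv\<close>.\<close>
  have form: "form_A \<alpha> q p w \<phi> = (\<integral>x. R g x * \<psi> x \<partial>lebD)"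
    if w: "is_wderiv w g" and \<phi>: "is_wderiv \<phi> \<psi>" for w g \<phi> \<psi>
  proof -
    let ?g = "wderiv w" and ?\<psi> = "wderiv \<phi>"
    have w': "is_wderiv w ?g" and \<phi>': "is_wderiv \<phi> ?\<psi>"
      by (intro is_wderiv_wderiv is_wderiv_imp_H10[OF w] is_wderiv_imp_H10[OF \<phi>])+
    have RLD: "RLD \<alpha> w x = K ?g x" if "x \<in> {0..1}" for x
      unfolding RLD_def set_integral_lebD[OF that] K_def rl_kernel_def
      by (simp add: mult_ac flip: integral_mult_right_zero)
    have "ipD (RLD \<alpha> w) (\<lambda>x. q x * \<phi> x) = (\<integral>x. K ?g x * (q x * prim ?\<psi> x) \<partial>lebD)"
      unfolding ipD_eq
      by (intro Bochner_Integration.integral_cong) (auto simp: RLD is_wderivD(4)[OF \<phi>'])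
    moreover have "ipD p \<phi> = (\<integral>x. p x * prim ?\<psi> x \<partial>lebD)"
      unfolding ipD_eq
      by (intro Bochner_Integration.integral_cong) (auto simp: is_wderivD(4)[OF \<phi>'])
    ultimately have "form_A \<alpha> q p w \<phi> = (\<integral>x. R ?g x * ?\<psi> x \<partial>lebD)"
      using weak_form_eq[OF is_wderivD(1)[OF w'] p is_wderivD(1,3)[OF \<phi>']] RLD[of 1]
      by (simp add: form_A_def form_a_def form_b_def ipD_eq R_def)
    also have "\<dots> = (\<integral>x. R g x * \<psi> x \<partial>lebD)"
    proof (rule integral_cong_AE)
      have m: "?g \<in> borel_measurable lebD" "g \<in> borel_measurable lebD"
        using is_wderivD(1)[OF w] is_wderivD(1)[OF w'] by auto
      have R_eq: "R ?g x = R g x" if "?g x = g x" for x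
        using that S_cong_AE[OF is_wderiv_unique[OF w' w] m]
          K_cong_AE[OF is_wderiv_unique[OF w' w] m, of 1] by (simp add: R_def)
      show "AE x in lebD. R ?g x * ?\<psi> x = R g x * \<psi> x"
        using is_wderiv_unique[OF w' w] is_wderiv_unique[OF \<phi>' \<phi>]
        by eventually_elim (simp add: R_eq)
    qed (use sq_integrable_mult sqR is_wderivD(1) w w' \<phi> \<phi>' in blast)+
    finally show ?thesis .
  qed
  obtain f where f: "sq_integrable lebD f"
    and Ff: "\<And>\<phi> \<psi>. is_wderiv \<phi> \<psi> \<Longrightarrow> F \<phi> = (\<integral>x. f x * \<psi> x \<partial>lebD)"
    using dualV_Riesz[OF \<open>dualV F\<close>] by blast
  \<comment> \<open>An additive constant in \<open>R g\<close> is orthogonal to every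
    \<open>\<psi>\<close>, because \<open>\<psi>\<close> has mean zero.\<close>
  have const: "(\<integral>x. R g x * \<psi> x \<partial>lebD) = (\<integral>x. h x * \<psi> x \<partial>lebD)"
    if R: "\<And>t. t \<in> {0..1} \<Longrightarrow> R g t = h t + c" and h: "sq_integrable lebD h"
      and \<phi>: "is_wderiv \<phi> \<psi>" for g h c \<phi> \<psi>
  proof -
    have "(\<integral>x. R g x * \<psi> x \<partial>lebD) = (\<integral>x. h x * \<psi> x + c * \<psi> x \<partial>lebD)"
      by (intro Bochner_Integration.integral_cong) (auto simp: R algebra_simps)
    then show ?thesis
      using sq_integrable_mult[OF h is_wderivD(1)[OF \<phi>]] is_wderivD(2,3)[OF \<phi>] by simp
  qed
  obtain g c where g: "sq_integrable lebD g" "(\<integral>t. g t \<partial>lebD) = 0"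
    and gc: "\<And>t. t \<in> {0..1} \<Longrightarrow> g t - S g t - K g 1 * prim p t = f t + c"
  proof (rule perturbed_equation_solvable[OF sq_integrable_prim[OF I[OF p]] _ f])
    fix g c
    assume g: "sq_integrable lebD g" "(\<integral>t. g t \<partial>lebD) = 0"
      and gc: "\<And>t. t \<in> {0..1} \<Longrightarrow> g t - S g t - K g 1 * prim p t = c"
    \<comment> \<open>Hypothesis (a) supplies injectivity: the primitive of a solution of the
      homogeneous equation is annihilated by the form, hence zero, and then so is \<open>g\<close>
      almost everywhere.\<close>
    define w where "w x = (if x \<in> {0..1} then prim g x else 0)" for x
    have w: "is_wderiv w g" unfolding w_def by (rule is_wderiv_primitive[OF g])
    have "form_A \<alpha> q p w v = 0" if "v \<in> H10" for v
      using const[of g "\<lambda>x. 0" c v "wderiv v"] form[OF w is_wderiv_wderiv[OF that]]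
        is_wderiv_wderiv[OF that] gc sq_integrable_const[OF lebD.finite_measure_axioms]
      by (simp add: R_def)
    then have "w = (\<lambda>x. 0)" using w by (intro assms(5)) (auto simp: H10_iff)
    then have "prim g x = 0" if "x \<in> {0..1}" for x
      using is_wderivD(4)[OF w that] by simp
    then show "AE t in lebD. g t = 0" using g by (intro prim_eq_0_imp_AE I)
  qed blast
  define w where "w x = (if x \<in> {0..1} then prim g x else 0)" for x
  have w: "is_wderiv w g" unfolding w_def by (rule is_wderiv_primitive[OF g])
  show ?thesis
  proof (rule ex1I[of _ w])
    have "form_A \<alpha> q p w \<phi> = F \<phi>" if "\<phi> \<in> H10" for \<phi>
      using is_wderiv_wderiv[OF that] const[OF _ f, of g c \<phi>] gc by (simp add: form[OF w] Ff R_def)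
    then show "w \<in> H10 \<and> (\<forall>\<phi>\<in>H10. form_A \<alpha> q p w \<phi> = F \<phi>)"
      using w by (auto simp: H10_iff)
  next
    fix v assume v: "v \<in> H10 \<and> (\<forall>\<phi>\<in>H10. form_A \<alpha> q p v \<phi> = F \<phi>)"
    then have v': "is_wderiv v (wderiv v)" by (simp add: is_wderiv_wderiv)
    \<comment> \<open>The difference of two solutions solves the homogeneous problem, so hypothesis
      (a) applies again.\<close>
    let ?d = "\<lambda>x. 1 * v x + (- 1) * w x" and ?g = "\<lambda>x. 1 * wderiv v x + (- 1) * g x"
    have d: "is_wderiv ?d ?g" by (rule is_wderiv_lincomb[OF v' w])
    have "form_A \<alpha> q p ?d \<phi> = 0" if "\<phi> \<in> H10" for \<phi>
    proof -
      note \<phi> = is_wderiv_wderiv[OF that]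
      have "form_A \<alpha> q p ?d \<phi> = (\<integral>x. R (wderiv v) x * wderiv \<phi> x - R g x * wderiv \<phi> x \<partial>lebD)"
        unfolding form[OF d \<phi>] R_lincomb[OF is_wderivD(1)[OF v'] g(1)]
        by (simp add: algebra_simps)
      also have "\<dots> = form_A \<alpha> q p v \<phi> - form_A \<alpha> q p w \<phi>"
        unfolding form[OF v' \<phi>] form[OF w \<phi>]
        by (intro Bochner_Integration.integral_diff sq_integrable_mult sqR is_wderivD(1)[OF v']
            is_wderivD(1)[OF \<phi>] g(1))
      also have "form_A \<alpha> q p v \<phi> = F \<phi>" using v that by simp
      also have "form_A \<alpha> q p w \<phi> = F \<phi>"
        using \<phi> const[OF _ f, of g c \<phi>] gc by (simp add: form[OF w] Ff R_def)
      finally show ?thesis by simp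
    qed
    then have "?d = (\<lambda>x. 0)" using d by (intro assms(5)) (auto simp: H10_iff)
    then have "v x - w x = 0" for x by (auto dest: fun_cong[of _ _ x])
    then show "v = w" by (auto simp: fun_eq_iff)
  qed
qed

end
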